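(* Let $Q$ be a precoherent near prequantale and let $M$ be a multiplicative semilattice. (1) $\mathsf{Idl}(M)$ is a precoherent near prequantale under $\downarrow$-multiplication $(I,J)\mapsto\ \downarrow\!(IJ)$. (2) $\mathsf{K}(Q)$ is a multiplicative semilattice. (3) The map $M \to \mathsf{K}(\mathsf{Idl}(M))$ acting by $x \mapsto\ \downarrow\! x$ is an isomorphism of ordered magmas. (4) The map $\mathsf{Idl}(\mathsf{K}(Q)) \to Q$ acting by $I \mapsto \bigvee I$ is an isomorphism of ordered magmas. (5) If $f: Q \to Q'$ is a morphism of precoherent near prequantales, then the map $\mathsf{K}(f): \mathsf{K}(Q) \to \mathsf{K}(Q')$ given by $\mathsf{K}(f)(x) = f(x)$ for all $x \in \mathsf{K}(Q)$ is a morphism of multiplicative semilattices. (6) If $g: M \to M'$ is a morphism of multiplicative semilattices, then the map $\mathsf{Idl}(g): \mathsf{Idl}(M) \to \mathsf{Idl}(M')$ given by $\mathsf{Idl}(g)(I) =\ \downarrow\!(g(I))$ for all $I \in \mathsf{Idl}(M)$ is a morphism of precoherent near prequantales. (7) The associations $\mathsf{K}$ and $\mathsf{Idl}$ are functorial and provide an equivalence of categories between the category of precoherent near prequantales and the category of multiplicative semilattices.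
   Context: An ordered magma is a set with a binary operation (written multiplicatively) and a partial order such that $x\le x'$, $y \le y'$ imply $xy \le x'y'$; isomorphisms of ordered magmas are order isomorphisms that are magma homomorphisms. A near prequantale is an ordered magma $Q$ such that $\bigvee X$ exists and $a(\bigvee X) = \bigvee(aX)$, $(\bigvee X)a = \bigvee(Xa)$ for every $a \in Q$ and every nonempty $X\subseteq Q$. A multiplicative semilattice is an ordered magma $M$ that is a join semilattice with $a(x\vee y) = ax \vee ay$ and $(x\vee y)a = xa\vee ya$ for all $a,x,y\in M$; a morphism of multiplicative semilattices is a magma homomorphism preserving suprema of finite nonempty subsets. A directed subset of a poset is a nonempty subset $\Delta$ in which every finite subset has an upper bound in $\Delta$. An element $x$ of a poset $S$ is compact if, whenever $x \le \bigvee\Delta$ for a directed $\Delta\subseteq S$ for which $\bigvee\Delta$ exists, one has $x \le y$ for some $y \in \Delta$; $\mathsf{K}(S)$ is the set of compact elements of $S$. An ordered magma $M$ is precoherent if every element of $M$ is the supremum of a set of compact elements and $\mathsf{K}(M)$ is closed under multiplication. A morphism of near prequantales is a magma homomorphism $f$ with $f(\bigvee X) = \bigvee f(X)$ for all nonempty $X$; a morphism $f:Q\to Q'$ of precoherent near prequantales is such a map with $Q,Q'$ precoherent and $f(\mathsf{K}(Q)) \subseteq \mathsf{K}(Q')$. An ideal of a poset $S$ is a directed downward closed subset of $S$; $\mathsf{Idl}(S)$ is the set of ideals of $S$ ordered by inclusion. For $x\in S$, $\downarrow\! x = \{y\in S: y\le x\}$; for a join semilattice $S$ and nonempty $X\subseteq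 S$, $\downarrow\! X = \{y\in S: y\le \bigvee T \text{ for some finite nonempty } T\subseteq X\}$. For subsets $I,J$ of a magma, $IJ = \{xy: x\in I, y\in J\}$. *)

theory Defs
  imports "HOL-Algebra.Lattice" "HOL-Library.FuncSet" "HOL-Library.Equipollence"
begin

section \<open>Ordered magmas\<close>

text \<open>Carriers are allowed to be empty.\<close>

record 'a omagma = "'a gorder" +
  omult :: "'a \<Rightarrow> 'a \<Rightarrow> 'a" (infixl "\<cdot>\<index>" 70)

locale ordered_magma = partial_order M for M (structure) +
  assumes omult_closed: "\<lbrakk>x \<in> carrier M; y \<in> carrier M\<rbrakk> \<Longrightarrow> x \<cdot> y \<in> carrier M"
    and omult_mono:
      "\<lbrakk>x \<in> carrier M; x' \<in> carrier M; y \<in> carrier M; y' \<in> carrier M; x \<sqsubseteq> x'; y \<sqsubseteq> y'\<rbrakk>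
        \<Longrightarrow> x \<cdot> y \<sqsubseteq> x' \<cdot> y'"

definition magma_hom :: "('a, 'c) omagma_scheme \<Rightarrow> ('b, 'd) omagma_scheme \<Rightarrow> ('a \<Rightarrow> 'b) set" where
  "magma_hom M N = {f \<in> carrier M \<rightarrow> carrier N.
     \<forall>x\<in>carrier M. \<forall>y\<in>carrier M. f (x \<cdot>\<^bsub>M\<^esub> y) = f x \<cdot>\<^bsub>N\<^esub> f y}"

definition omagma_iso :: "('a, 'c) omagma_scheme \<Rightarrow> ('b, 'd) omagma_scheme \<Rightarrow> ('a \<Rightarrow> 'b) \<Rightarrow> bool" where
  "omagma_iso M N f \<longleftrightarrow>
     ordered_magma M \<and> ordered_magma N \<and> f \<in> magma_hom M N \<and>
     order_emb M N f \<and> bij_betw f (carrier M) (carrier N)"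

locale near_prequantale = ordered_magma Q for Q (structure) +
  assumes Sup_exists: "\<lbrakk>X \<subseteq> carrier Q; X \<noteq> {}\<rbrakk> \<Longrightarrow> \<exists>s. is_lub Q s X"
    and omult_Sup_left:
      "\<lbrakk>a \<in> carrier Q; X \<subseteq> carrier Q; X \<noteq> {}\<rbrakk> \<Longrightarrow> a \<cdot> (\<Squnion>X) = \<Squnion>((\<lambda>x. a \<cdot> x) ` X)"
    and omult_Sup_right:
      "\<lbrakk>a \<in> carrier Q; X \<subseteq> carrier Q; X \<noteq> {}\<rbrakk> \<Longrightarrow> (\<Squnion>X) \<cdot> a = \<Squnion>((\<lambda>x. x \<cdot> a) ` X)"

locale multiplicative_semilattice = ordered_magma M + upper_semilattice M for M (structure) +
  assumes omult_join_left:
      "\<lbrakk>a \<in> carrier M; x \<in> carrier M; y \<in> carrier M\<rbrakk> \<Longrightarrow> a \<cdot> (x \<squnion> y) = (a \<cdot> x) \<squnion> (a \<cdot> y)"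
    and omult_join_right:
      "\<lbrakk>a \<in> carrier M; x \<in> carrier M; y \<in> carrier M\<rbrakk> \<Longrightarrow> (x \<squnion> y) \<cdot> a = (x \<cdot> a) \<squnion> (y \<cdot> a)"

definition mult_semilattice_mor ::
    "('a, 'c) omagma_scheme \<Rightarrow> ('b, 'd) omagma_scheme \<Rightarrow> ('a \<Rightarrow> 'b) \<Rightarrow> bool" where
  "mult_semilattice_mor M N g \<longleftrightarrow>
     multiplicative_semilattice M \<and> multiplicative_semilattice N \<and> g \<in> magma_hom M N \<and>
     (\<forall>X. X \<subseteq> carrier M \<and> finite X \<and> X \<noteq> {} \<longrightarrow> g (\<Squnion>\<^bsub>M\<^esub>X) = \<Squnion>\<^bsub>N\<^esub>(g ` X))"

section \<open>Compact elements and precoherence\<close>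

definition directed_subset :: "('a, 'c) gorder_scheme \<Rightarrow> 'a set \<Rightarrow> bool" where
  "directed_subset S D \<longleftrightarrow> D \<subseteq> carrier S \<and> D \<noteq> {} \<and>
     (\<forall>F. F \<subseteq> D \<and> finite F \<longrightarrow> (\<exists>d\<in>D. \<forall>x\<in>F. x \<sqsubseteq>\<^bsub>S\<^esub> d))"

definition compacts :: "('a, 'c) gorder_scheme \<Rightarrow> 'a set" where
  "compacts S = {x \<in> carrier S.
     \<forall>D s. directed_subset S D \<and> is_lub S s D \<and> x \<sqsubseteq>\<^bsub>S\<^esub> s \<longrightarrow> (\<exists>y\<in>D. x \<sqsubseteq>\<^bsub>S\<^esub> y)}"

locale precoherent = ordered_magma M for M (structure) +
  assumes compactly_generated:
      "x \<in> carrier M \<Longrightarrow> \<exists>X. X \<subseteq> compacts M \<and> is_lub M x X"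
    and compacts_closed: "\<lbrakk>x \<in> compacts M; y \<in> compacts M\<rbrakk> \<Longrightarrow> x \<cdot> y \<in> compacts M"

locale precoherent_near_prequantale = near_prequantale Q + precoherent Q for Q (structure)

definition near_prequantale_mor ::
    "('a, 'c) omagma_scheme \<Rightarrow> ('b, 'd) omagma_scheme \<Rightarrow> ('a \<Rightarrow> 'b) \<Rightarrow> bool" where
  "near_prequantale_mor Q R f \<longleftrightarrow>
     near_prequantale Q \<and> near_prequantale R \<and> f \<in> magma_hom Q R \<and>
     (\<forall>X. X \<subseteq> carrier Q \<and> X \<noteq> {} \<longrightarrow> f (\<Squnion>\<^bsub>Q\<^esub>X) = \<Squnion>\<^bsub>R\<^esub>(f ` X))"

definition precoherent_mor ::
    "('a, 'c) omagma_scheme \<Rightarrow> ('b, 'd) omagma_scheme \<Rightarrow> ('a \<Rightarrow> 'b) \<Rightarrow> bool" where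
  "precoherent_mor Q R f \<longleftrightarrow>
     near_prequantale_mor Q R f \<and> precoherent Q \<and> precoherent R \<and> f ` compacts Q \<subseteq> compacts R"

definition K_magma :: "'a omagma \<Rightarrow> 'a omagma" where
  "K_magma Q = Q\<lparr>carrier := compacts Q\<rparr>"

definition K_map :: "'a omagma \<Rightarrow> ('a \<Rightarrow> 'b) \<Rightarrow> 'a \<Rightarrow> 'b" where
  "K_map Q f = restrict f (compacts Q)"

section \<open>Ideals\<close>

definition order_ideals :: "('a, 'c) gorder_scheme \<Rightarrow> 'a set set" where
  "order_ideals S = {I. directed_subset S I \<and> (\<forall>x\<in>I. \<forall>y\<in>carrier S. y \<sqsubseteq>\<^bsub>S\<^esub> x \<longrightarrow> y \<in> I)}"

definition down_elem :: "('a, 'c) gorder_scheme \<Rightarrow> 'a \<Rightarrow> 'a set" where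
  "down_elem S x = {y \<in> carrier S. y \<sqsubseteq>\<^bsub>S\<^esub> x}"

definition down_set :: "('a, 'c) gorder_scheme \<Rightarrow> 'a set \<Rightarrow> 'a set" where
  "down_set S X = {y \<in> carrier S. \<exists>T. finite T \<and> T \<noteq> {} \<and> T \<subseteq> X \<and> y \<sqsubseteq>\<^bsub>S\<^esub> \<Squnion>\<^bsub>S\<^esub>T}"

definition set_omult :: "('a, 'c) omagma_scheme \<Rightarrow> 'a set \<Rightarrow> 'a set \<Rightarrow> 'a set" where
  "set_omult M I J = {x \<cdot>\<^bsub>M\<^esub> y | x y. x \<in> I \<and> y \<in> J}"

definition Idl_magma :: "'a omagma \<Rightarrow> 'a set omagma" where
  "Idl_magma M = \<lparr>carrier = order_ideals M, eq = (=), le = (\<subseteq>),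
     omult = (\<lambda>I J. down_set M (set_omult M I J))\<rparr>"

definition Idl_map :: "'a omagma \<Rightarrow> 'b omagma \<Rightarrow> ('a \<Rightarrow> 'b) \<Rightarrow> 'a set \<Rightarrow> 'b set" where
  "Idl_map M N g = (\<lambda>I\<in>order_ideals M. down_set N (g ` I))"

section \<open>Categories\<close>

text \<open>Hom-sets are indexed by pairs of objects and need not be disjoint, so identities,
  composition and the action of functors on arrows take the objects as arguments.\<close>

record ('o, 'm) cat =
  Obj :: "'o set"
  Hom :: "'o \<Rightarrow> 'o \<Rightarrow> 'm set"
  Id :: "'o \<Rightarrow> 'm"
  Comp :: "'o \<Rightarrow> 'o \<Rightarrow> 'o \<Rightarrow> 'm \<Rightarrow> 'm \<Rightarrow> 'm"

locale category =
  fixes C :: "('o, 'm) cat"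
  assumes Id_Hom: "A \<in> Obj C \<Longrightarrow> Id C A \<in> Hom C A A"
    and Comp_Hom:
      "\<lbrakk>A \<in> Obj C; B \<in> Obj C; D \<in> Obj C; f \<in> Hom C A B; g \<in> Hom C B D\<rbrakk>
        \<Longrightarrow> Comp C A B D g f \<in> Hom C A D"
    and Comp_Id_left:
      "\<lbrakk>A \<in> Obj C; B \<in> Obj C; f \<in> Hom C A B\<rbrakk> \<Longrightarrow> Comp C A B B (Id C B) f = f"
    and Comp_Id_right:
      "\<lbrakk>A \<in> Obj C; B \<in> Obj C; f \<in> Hom C A B\<rbrakk> \<Longrightarrow> Comp C A A B f (Id C A) = f"
    and Comp_assoc:
      "\<lbrakk>A \<in> Obj C; B \<in> Obj C; D \<in> Obj C; E \<in> Obj C;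
        f \<in> Hom C A B; g \<in> Hom C B D; h \<in> Hom C D E\<rbrakk>
        \<Longrightarrow> Comp C A B E (Comp C B D E h g) f = Comp C A D E h (Comp C A B D g f)"

definition iso_arrow :: "('o, 'm) cat \<Rightarrow> 'o \<Rightarrow> 'o \<Rightarrow> 'm \<Rightarrow> bool" where
  "iso_arrow C A B f \<longleftrightarrow> f \<in> Hom C A B \<and>
     (\<exists>g\<in>Hom C B A. Comp C A B A g f = Id C A \<and> Comp C B A B f g = Id C B)"

record ('o, 'm, 'p, 'n) ftor =
  on_obj :: "'o \<Rightarrow> 'p"
  on_arr :: "'o \<Rightarrow> 'o \<Rightarrow> 'm \<Rightarrow> 'n"

locale cat_functor = C: category C + D: category D
    for C :: "('o, 'm) cat" and D :: "('p, 'n) cat" +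
  fixes F :: "('o, 'm, 'p, 'n) ftor"
  assumes on_obj_Obj: "A \<in> Obj C \<Longrightarrow> on_obj F A \<in> Obj D"
    and on_arr_Hom:
      "\<lbrakk>A \<in> Obj C; B \<in> Obj C; f \<in> Hom C A B\<rbrakk>
        \<Longrightarrow> on_arr F A B f \<in> Hom D (on_obj F A) (on_obj F B)"
    and on_arr_Id: "A \<in> Obj C \<Longrightarrow> on_arr F A A (Id C A) = Id D (on_obj F A)"
    and on_arr_Comp:
      "\<lbrakk>A \<in> Obj C; B \<in> Obj C; E \<in> Obj C; f \<in> Hom C A B; g \<in> Hom C B E\<rbrakk>
        \<Longrightarrow> on_arr F A E (Comp C A B E g f) =
            Comp D (on_obj F A) (on_obj F B) (on_obj F E) (on_arr F B E g) (on_arr F A B f)"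

definition id_ftor :: "('o, 'm, 'o, 'm) ftor" where
  "id_ftor = \<lparr>on_obj = (\<lambda>A. A), on_arr = (\<lambda>A B f. f)\<rparr>"

definition comp_ftor ::
    "('p, 'n, 'q, 'l) ftor \<Rightarrow> ('o, 'm, 'p, 'n) ftor \<Rightarrow> ('o, 'm, 'q, 'l) ftor" where
  "comp_ftor G F = \<lparr>on_obj = (\<lambda>A. on_obj G (on_obj F A)),
     on_arr = (\<lambda>A B f. on_arr G (on_obj F A) (on_obj F B) (on_arr F A B f))\<rparr>"

definition natural_iso ::
    "('o, 'm) cat \<Rightarrow> ('p, 'n) cat \<Rightarrow> ('o, 'm, 'p, 'n) ftor \<Rightarrow> ('o, 'm, 'p, 'n) ftor
      \<Rightarrow> ('o \<Rightarrow> 'n) \<Rightarrow> bool" where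
  "natural_iso C D F G \<eta> \<longleftrightarrow>
     cat_functor C D F \<and> cat_functor C D G \<and>
     (\<forall>A\<in>Obj C. iso_arrow D (on_obj F A) (on_obj G A) (\<eta> A)) \<and>
     (\<forall>A\<in>Obj C. \<forall>B\<in>Obj C. \<forall>f\<in>Hom C A B.
        Comp D (on_obj F A) (on_obj F B) (on_obj G B) (\<eta> B) (on_arr F A B f) =
        Comp D (on_obj F A) (on_obj G A) (on_obj G B) (on_arr G A B f) (\<eta> A))"

definition cat_equivalence ::
    "('o, 'm) cat \<Rightarrow> ('p, 'n) cat \<Rightarrow> ('o, 'm, 'p, 'n) ftor \<Rightarrow> ('p, 'n, 'o, 'm) ftor \<Rightarrow> bool" where
  "cat_equivalence C D F G \<longleftrightarrow>
     cat_functor C D F \<and> cat_functor D C G \<and>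
     (\<exists>\<eta>. natural_iso C C id_ftor (comp_ftor G F) \<eta>) \<and>
     (\<exists>\<epsilon>. natural_iso D D (comp_ftor F G) id_ftor \<epsilon>)"

section \<open>Universes and the two categories\<close>

text \<open>The ideals of a structure over a type \<open>'v\<close> form a structure over \<open>'v set\<close>, so a
  category closed under \<open>Idl\<close> needs a universe: a type \<open>'v\<close> with a notion of small subset and a
  way to regard small subsets of \<open>'v\<close> as elements of \<open>'v\<close>, as for sets inside the class of all
  sets. By \<open>universe_lepoll\<close> below, universes exist in which every set of cardinality at most that of
  an arbitrary given infinite type occurs as a small set, up to bijection.\<close>

definition universe :: "('v set \<Rightarrow> bool) \<Rightarrow> ('v set \<Rightarrow> 'v) \<Rightarrow> bool" where
  "universe small code \<longleftrightarrow>
     (\<forall>A B. small A \<and> B \<subseteq> A \<longrightarrow> small B) \<and>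
     (\<forall>A f. small A \<longrightarrow> small (f ` A)) \<and>
     inj_on code {A. small A}"

lemma universe_lepoll:
  assumes inf: "infinite (UNIV :: 'u set)"
  shows "\<exists>code. universe (\<lambda>A :: 'u set set. A \<lesssim> (UNIV :: 'u set)) code"
proof -
  let ?small = "\<lambda>A :: 'u set set. A \<lesssim> (UNIV :: 'u set)"
  obtain p :: "'u \<times> 'u \<Rightarrow> 'u" where p: "inj p"
    using card_of_Times_same_infinite[OF inf] card_of_ordIso[of "UNIV \<times> UNIV" UNIV]
    by (auto simp: bij_betw_def)
  obtain a b :: 'u where ab: "a \<noteq> b"
    using inf by (metis (full_types) UNIV_eq_I finite.simps insertI1)
  define h where "h A = (SOME f :: 'u set \<Rightarrow> 'u. inj_on f A)" for A :: "'u set set"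
  have h: "inj_on (h A) A" if "?small A" for A
    using that someI_ex[of "\<lambda>f :: 'u set \<Rightarrow> 'u. inj_on f A"] unfolding h_def lepoll_def by blast
  define code where "code A = p ` ({(h A x, p (a, y)) | x y. x \<in> A \<and> y \<in> x} \<union>
     {(h A x, p (b, b)) | x. x \<in> A})" for A
  have dec: "A = {{y. p (i, p (a, y)) \<in> code A} | i. p (i, p (b, b)) \<in> code A}" if "?small A" for A
  proof -
    have 1: "p (i, p (b, b)) \<in> code A \<longleftrightarrow> (\<exists>x\<in>A. i = h A x)" for i
      using p ab unfolding code_def by (auto simp: inj_eq image_iff)
    have 2: "p (i, p (a, y)) \<in> code A \<longleftrightarrow> (\<exists>x\<in>A. i = h A x \<and> y \<in> x)" for i y
      using p ab unfolding code_def by (auto simp: inj_eq image_iff)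
    have 3: "{y. p (h A x, p (a, y)) \<in> code A} = x" if "x \<in> A" for x
      unfolding 2 using h[OF \<open>?small A\<close>] that by (auto dest: inj_onD)
    have "{{y. p (i, p (a, y)) \<in> code A} | i. \<exists>x\<in>A. i = h A x} =
        (\<lambda>x. {y. p (h A x, p (a, y)) \<in> code A}) ` A" by blast
    also have "\<dots> = A" using 3 by simp
    finally show ?thesis unfolding 1 by simp
  qed
  have "inj_on code {A. ?small A}"
  proof (rule inj_onI)
    fix A B assume "A \<in> {A. ?small A}" "B \<in> {A. ?small A}" and eq: "code A = code B"
    then have small: "?small A" "?small B" by simp_all
    from dec[OF small(1)] dec[OF small(2)] show "A = B" unfolding eq by (rule trans[OF _ sym])
  qed
  moreover have "\<forall>A B. ?small A \<and> B \<subseteq> A \<longrightarrow> ?small B"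
    by (meson lepoll_trans subset_imp_lepoll)
  moreover have "\<forall>A f. ?small A \<longrightarrow> ?small (f ` A)"
    by (meson image_lepoll lepoll_trans)
  ultimately show ?thesis
    unfolding universe_def by blast
qed

definition transport :: "('a \<Rightarrow> 'b) \<Rightarrow> 'a omagma \<Rightarrow> 'b omagma" where
  "transport c M = (let d = inv_into (carrier M) c in
     \<lparr>carrier = c ` carrier M, eq = (=), le = (\<lambda>x y. d x \<sqsubseteq>\<^bsub>M\<^esub> d y),
      omult = (\<lambda>x y. c (d x \<cdot>\<^bsub>M\<^esub> d y))\<rparr>)"

text \<open>Arrows are extensional functions on carriers. Smallness of a precoherent near prequantale
  \<open>Q\<close> means smallness of \<open>K(Q)\<close>. As \<open>Q\<close> embeds into the power set of \<open>K(Q)\<close>, this agrees with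
  smallness of the carrier in universes whose small sets are closed under power sets.\<close>

definition PNP_cat :: "('v set \<Rightarrow> bool) \<Rightarrow> ('v omagma, 'v \<Rightarrow> 'v) cat" where
  "PNP_cat small =
     \<lparr>Obj = {Q. precoherent_near_prequantale Q \<and> small (compacts Q)},
      Hom = (\<lambda>Q R. {f \<in> extensional (carrier Q). precoherent_mor Q R f}),
      Id = (\<lambda>Q. \<lambda>x\<in>carrier Q. x),
      Comp = (\<lambda>Q R S g f. compose (carrier Q) g f)\<rparr>"

definition MS_cat :: "('v set \<Rightarrow> bool) \<Rightarrow> ('v omagma, 'v \<Rightarrow> 'v) cat" where
  "MS_cat small =
     \<lparr>Obj = {M. multiplicative_semilattice M \<and> small (carrier M)},
      Hom = (\<lambda>M N. {g \<in> extensional (carrier M). mult_semilattice_mor M N g}),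
      Id = (\<lambda>M. \<lambda>x\<in>carrier M. x),
      Comp = (\<lambda>M N P g f. compose (carrier M) g f)\<rparr>"

definition K_functor :: "('v omagma, 'v \<Rightarrow> 'v, 'v omagma, 'v \<Rightarrow> 'v) ftor" where
  "K_functor = \<lparr>on_obj = K_magma, on_arr = (\<lambda>Q R. K_map Q)\<rparr>"

text \<open>\<open>Idl\<close>, with each ideal replaced by its code in the universe.\<close>

definition Idl_functor ::
    "('v set \<Rightarrow> 'v) \<Rightarrow> ('v omagma, 'v \<Rightarrow> 'v, 'v omagma, 'v \<Rightarrow> 'v) ftor" where
  "Idl_functor code =
     \<lparr>on_obj = (\<lambda>M. transport code (Idl_magma M)),
      on_arr = (\<lambda>M N g. \<lambda>x\<in>code ` order_ideals M.
         code (Idl_map M N g (inv_into (order_ideals M) code x)))\<rparr>"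

end

theory Submission
  imports Defs
begin

text \<open>The supremum of a directed family of ideals is its union, so the compact elements of
  \<open>Idl(M)\<close> are the principal ideals. Conversely, in a precoherent near prequantale \<open>Q\<close> compactness
  says that an ideal \<open>I\<close> of \<open>K(Q)\<close> consists of all compact elements below its supremum, and compact
  generation says that \<open>x\<close> is the supremum of the compact elements below it, which form an ideal as
  finite suprema of compact elements are compact. Hence \<open>I \<mapsto> \<Squnion>I\<close> and \<open>x \<mapsto> {k \<in> K(Q). k \<le> x}\<close>
  are mutually inverse. All notions involved are invariant under isomorphism of ordered
  magmas, so the equivalence survives the coding of ideals as elements of the universe.\<close>

section \<open>Suprema and directed sets\<close>

text \<open>Two kinds of generated ideal occur. Products of ideals, and images of ideals under
  morphisms, are generated by directed sets, so a plain downward closure results and can be computed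
  elementwise. The union of an arbitrary family of ideals need not be directed, and finite joins
  enter. There a bound on the members of the family is carried over to the supremum by showing that
  the elements satisfying the bound themselves form an ideal; this is where distributivity of M, and
  for morphisms the preservation of joins, does its work. On the side of Q the laws speak of
  nonempty sets, whereas compact generation admits the empty supremum, so a least element has to be
  treated by itself. Compatibility with order and product is checked for I \<mapsto> \<Squnion>I,
  and its inverse inherits both.\<close>

lemma is_lub_iff:
  assumes "A \<subseteq> carrier L"
  shows "is_lub L s A \<longleftrightarrow> s \<in> carrier L \<and> (\<forall>x\<in>A. x \<sqsubseteq>\<^bsub>L\<^esub> s) \<and>
    (\<forall>y\<in>carrier L. (\<forall>x\<in>A. x \<sqsubseteq>\<^bsub>L\<^esub> y) \<longrightarrow> s \<sqsubseteq>\<^bsub>L\<^esub> y)"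
  using assms unfolding least_def Upper_def by blast

lemma (in partial_order) sup_eqI: "is_lub L s A \<Longrightarrow> \<Squnion>A = s"
  unfolding sup_def by (rule some_equality) (auto intro: least_unique)

lemma (in partial_order) is_lub_pair:
  "\<lbrakk>x \<sqsubseteq> y; x \<in> carrier L; y \<in> carrier L\<rbrakk> \<Longrightarrow> is_lub L y {x, y}"
  by (subst is_lub_iff) auto

text \<open>Induction adds the elements of the finite subset one at a time; the empty subset is
  where nonemptiness of \<open>D\<close> enters. Directedness of products, images and families of
  principal ideals is checked in this two-element form, while \<open>down_set_least\<close> and
  \<open>compacts_finite_Sup\<close> draw on the finite form.\<close>

lemma (in weak_partial_order) directed_subset_iff:
  "directed_subset L D \<longleftrightarrow> D \<subseteq> carrier L \<and> D \<noteq> {} \<and> (\<forall>x\<in>D. \<forall>y\<in>D. \<exists>z\<in>D. x \<sqsubseteq> z \<and> y \<sqsubseteq> z)"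
proof
  assume D: "directed_subset L D"
  have "\<exists>z\<in>D. x \<sqsubseteq> z \<and> y \<sqsubseteq> z" if "x \<in> D" "y \<in> D" for x y
  proof -
    have "{x, y} \<subseteq> D \<and> finite {x, y}" using that by simp
    with D show ?thesis unfolding directed_subset_def by (metis insertCI)
  qed
  with D show "D \<subseteq> carrier L \<and> D \<noteq> {} \<and> (\<forall>x\<in>D. \<forall>y\<in>D. \<exists>z\<in>D. x \<sqsubseteq> z \<and> y \<sqsubseteq> z)"
    unfolding directed_subset_def by simp
next
  assume D: "D \<subseteq> carrier L \<and> D \<noteq> {} \<and> (\<forall>x\<in>D. \<forall>y\<in>D. \<exists>z\<in>D. x \<sqsubseteq> z \<and> y \<sqsubseteq> z)"
  have "F \<subseteq> D \<longrightarrow> (\<exists>d\<in>D. \<forall>x\<in>F. x \<sqsubseteq> d)" if "finite F" for F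
    using that
  proof (induction F)
    case empty
    show ?case using D by auto
  next
    case (insert a F)
    show ?case
    proof
      assume sub: "insert a F \<subseteq> D"
      then obtain d where d: "d \<in> D" "\<forall>x\<in>F. x \<sqsubseteq> d"
        using insert.IH by auto
      then obtain z where z: "z \<in> D" "a \<sqsubseteq> z" "d \<sqsubseteq> z"
        using D sub by blast
      have "x \<sqsubseteq> z" if "x \<in> F" for x
        using D d z sub that le_trans[of x d z] by blast
      with z show "\<exists>d\<in>D. \<forall>x\<in>insert a F. x \<sqsubseteq> d"
        by blast
    qed
  qed
  with D show "directed_subset L D"
    unfolding directed_subset_def by blast
qed

context near_prequantale
begin

lemma Sup_is_lub: "\<lbrakk>X \<subseteq> carrier Q; X \<noteq> {}\<rbrakk> \<Longrightarrow> is_lub Q (\<Squnion>X) X"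
  using Sup_exists sup_eqI by metis

lemma Sup_closed: "\<lbrakk>X \<subseteq> carrier Q; X \<noteq> {}\<rbrakk> \<Longrightarrow> \<Squnion>X \<in> carrier Q"
  using Sup_is_lub by (rule least_closed)

lemma Sup_upper: "\<lbrakk>X \<subseteq> carrier Q; x \<in> X\<rbrakk> \<Longrightarrow> x \<sqsubseteq> \<Squnion>X"
  using Sup_is_lub[of X] least_Upper_above by fast

lemma Sup_least:
  "\<lbrakk>X \<subseteq> carrier Q; X \<noteq> {}; u \<in> carrier Q; \<And>x. x \<in> X \<Longrightarrow> x \<sqsubseteq> u\<rbrakk> \<Longrightarrow> \<Squnion>X \<sqsubseteq> u"
  using Sup_is_lub[of X] by (simp add: is_lub_iff)

text \<open>Distributing over the left factor and then over the right one reduces the product of two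
  suprema to the elementary products. It provides half of the multiplicativity of I \<mapsto>
  \<Squnion>I.\<close>

lemma omult_Sup_least:
  assumes X: "X \<subseteq> carrier Q" "X \<noteq> {}" and Y: "Y \<subseteq> carrier Q" "Y \<noteq> {}" and u: "u \<in> carrier Q"
    and le: "\<And>x y. x \<in> X \<Longrightarrow> y \<in> Y \<Longrightarrow> x \<cdot> y \<sqsubseteq> u"
  shows "\<Squnion>X \<cdot> \<Squnion>Y \<sqsubseteq> u"
proof -
  have "x \<cdot> \<Squnion>Y \<sqsubseteq> u" if "x \<in> X" for x
  proof -
    have "x \<cdot> \<Squnion>Y = \<Squnion>((\<lambda>y. x \<cdot> y) ` Y)"
      using X Y that by (intro omult_Sup_left) auto
    also have "\<dots> \<sqsubseteq> u"
      using X Y that u le by (intro Sup_least) (auto intro!: omult_closed)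
    finally show ?thesis .
  qed
  moreover have "\<Squnion>X \<cdot> \<Squnion>Y = \<Squnion>((\<lambda>x. x \<cdot> \<Squnion>Y) ` X)"
    using X Y by (intro omult_Sup_right Sup_closed) auto
  ultimately show ?thesis
    using X u Sup_closed[OF Y] by (auto intro!: Sup_least omult_closed)
qed

end

section \<open>Ideals of a join semilattice\<close>

context upper_semilattice
begin

text \<open>An upper bound of \<open>x\<close> and \<open>y\<close> inside \<open>I\<close> lies
  above their join, so downward closure puts the join itself into \<open>I\<close>. In this form a
  set is shown to be an ideal without any choice of upper bounds.\<close>

lemma order_ideals_iff:
  "I \<in> order_ideals L \<longleftrightarrow> I \<subseteq> carrier L \<and> I \<noteq> {} \<and> (\<forall>x\<in>I. \<forall>y\<in>I. x \<squnion> y \<in> I) \<and>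
    (\<forall>x\<in>I. \<forall>y\<in>carrier L. y \<sqsubseteq> x \<longrightarrow> y \<in> I)" (is "?L \<longleftrightarrow> ?R")
proof
  assume ?L
  moreover have "x \<squnion> y \<in> I" if xy: "x \<in> I" "y \<in> I" for x y
  proof -
    from \<open>?L\<close> have I: "I \<subseteq> carrier L" "\<And>x y. \<lbrakk>x \<in> I; y \<in> carrier L; y \<sqsubseteq> x\<rbrakk> \<Longrightarrow> y \<in> I"
      unfolding order_ideals_def directed_subset_iff by simp_all
    from \<open>?L\<close> xy obtain z where "z \<in> I" "x \<sqsubseteq> z" "y \<sqsubseteq> z"
      unfolding order_ideals_def directed_subset_iff by (simp, metis)
    then have "x \<squnion> y \<sqsubseteq> z"
      using I(1) xy by (intro join_le) auto
    with \<open>z \<in> I\<close> show ?thesis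
      using I xy by (meson join_closed subsetD)
  qed
  ultimately show ?R
    unfolding order_ideals_def directed_subset_iff by simp
next
  assume R: ?R
  then have "\<exists>z\<in>I. x \<sqsubseteq> z \<and> y \<sqsubseteq> z" if "x \<in> I" "y \<in> I" for x y
    using that join_left[of x y] join_right[of x y] by blast
  with R show ?L
    unfolding order_ideals_def directed_subset_iff by blast
qed

lemma down_elem_ideal: "x \<in> carrier L \<Longrightarrow> down_elem L x \<in> order_ideals L"
  unfolding order_ideals_iff down_elem_def
  by (auto intro: join_le le_trans)

text \<open>If finite sets \<open>S\<close> and \<open>T\<close> witness membership of
  \<open>y\<close> and \<open>z\<close>, then \<open>S \<union> T\<close> witnesses membership of
  their join.\<close>

lemma down_set_ideal:
  assumes "X \<subseteq> carrier L" "X \<noteq> {}"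
  shows "down_set L X \<in> order_ideals L"
  unfolding order_ideals_iff
proof (intro conjI ballI impI)
  show "down_set L X \<subseteq> carrier L"
    unfolding down_set_def by blast
  obtain x where "x \<in> X" using assms by blast
  then have "\<Squnion>{x} \<in> down_set L X"
    using assms unfolding down_set_def by (auto intro!: exI[of _ "{x}"])
  then show "down_set L X \<noteq> {}" by blast
next
  fix y z assume "y \<in> down_set L X" "z \<in> down_set L X"
  then obtain S T where y: "y \<in> carrier L" "finite S" "S \<noteq> {}" "S \<subseteq> X" "y \<sqsubseteq> \<Squnion>S"
    and z: "z \<in> carrier L" "finite T" "T \<noteq> {}" "T \<subseteq> X" "z \<sqsubseteq> \<Squnion>T"
    unfolding down_set_def by auto
  have ST: "finite (S \<union> T)" "S \<union> T \<noteq> {}" "S \<union> T \<subseteq> carrier L" "S \<subseteq> carrier L" "T \<subseteq> carrier L"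
    using y z assms by auto
  have "\<Squnion>S \<sqsubseteq> \<Squnion>(S \<union> T)" "\<Squnion>T \<sqsubseteq> \<Squnion>(S \<union> T)"
    using finite_sup_least[of S] finite_sup_least[of T] finite_sup_least[of "S \<union> T"] ST y z
    unfolding is_lub_iff[OF ST(3)] is_lub_iff[OF ST(4)] is_lub_iff[OF ST(5)] by simp_all
  then have "y \<squnion> z \<sqsubseteq> \<Squnion>(S \<union> T)"
    using y z ST by (meson join_le le_trans finite_sup_closed)
  then show "y \<squnion> z \<in> down_set L X"
    unfolding down_set_def using y z ST by (auto intro!: exI[of _ "S \<union> T"])
next
  fix x y assume "x \<in> down_set L X" "y \<in> carrier L" "y \<sqsubseteq> x"
  then show "y \<in> down_set L X"
    unfolding down_set_def using assms
    by (smt (verit) mem_Collect_eq le_trans finite_sup_closed subset_trans)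
qed

lemma down_set_superset:
  assumes "X \<subseteq> carrier L"
  shows "X \<subseteq> down_set L X"
proof
  fix x assume "x \<in> X"
  moreover from this assms have "x \<sqsubseteq> \<Squnion>{x}"
    using sup_eqI[OF sup_of_singletonI[of x]] by auto
  ultimately show "x \<in> down_set L X"
    unfolding down_set_def using assms by (auto intro!: exI[of _ "{x}"])
qed

text \<open>A finite \<open>T\<close> has an upper bound inside the ideal by directedness, and that
  bound dominates its supremum. Together with \<open>down_set_ideal\<close> and
  \<open>down_set_superset\<close> this says that \<open>down_set L X\<close> is the ideal generated
  by \<open>X\<close>; later proofs rest on these three facts and never return to the finite suprema
  in its definition.\<close>

lemma down_set_least:
  assumes I: "I \<in> order_ideals L" and X: "X \<subseteq> I"
  shows "down_set L X \<subseteq> I"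
proof
  fix y assume "y \<in> down_set L X"
  then obtain T where T: "finite T" "T \<noteq> {}" "T \<subseteq> X" "y \<sqsubseteq> \<Squnion>T" and y: "y \<in> carrier L"
    unfolding down_set_def by auto
  from I X T have "\<exists>d\<in>I. \<forall>x\<in>T. x \<sqsubseteq> d"
    unfolding order_ideals_def directed_subset_def by simp
  then obtain d where d: "d \<in> I" "\<forall>x\<in>T. x \<sqsubseteq> d" ..
  have TL: "T \<subseteq> carrier L" and dL: "d \<in> carrier L"
    using I X T d unfolding order_ideals_iff by auto
  have "\<Squnion>T \<sqsubseteq> d"
    using finite_sup_least[of T] T d TL dL unfolding is_lub_iff[OF TL] by blast
  then have "y \<sqsubseteq> d"
    using T TL y dL by (meson le_trans finite_sup_closed)
  with I d y show "y \<in> I"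
    unfolding order_ideals_iff by simp
qed

text \<open>The downward closure of a directed set is already an ideal, so minimality of the
  generated ideal forces equality. This is what makes products and images of ideals computable
  elementwise.\<close>

lemma down_set_directed:
  assumes "directed_subset L X"
  shows "down_set L X = {z \<in> carrier L. \<exists>x\<in>X. z \<sqsubseteq> x}" (is "_ = ?I")
proof
  have X: "X \<subseteq> carrier L" "X \<noteq> {}"
    using assms unfolding directed_subset_def by auto
  have "y \<squnion> z \<in> ?I" if yz: "y \<in> ?I" "z \<in> ?I" for y z
  proof -
    obtain a b where ab: "a \<in> X" "y \<sqsubseteq> a" "b \<in> X" "z \<sqsubseteq> b"
      using yz by blast
    then obtain c where c: "c \<in> X" "a \<sqsubseteq> c" "b \<sqsubseteq> c"
      using assms unfolding directed_subset_iff by metis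
    have "y \<sqsubseteq> c" "z \<sqsubseteq> c"
      using yz ab c X le_trans[of y a c] le_trans[of z b c] by auto
    then show ?thesis
      using yz c X by (auto intro!: bexI[of _ c] join_le)
  qed
  moreover have "?I \<noteq> {}" using X le_refl by fast
  ultimately have "?I \<in> order_ideals L"
    unfolding order_ideals_iff using X
    by (simp add: subset_iff) (meson le_trans)
  then show "down_set L X \<subseteq> ?I"
    using X le_refl by (intro down_set_least) fast+
  show "?I \<subseteq> down_set L X"
    using down_set_ideal[OF X] down_set_superset[OF X(1)] unfolding order_ideals_iff by blast
qed

end

section \<open>The near prequantale of ideals\<close>

lemma Idl_simps [simp]:
  "carrier (Idl_magma M) = order_ideals M" "eq (Idl_magma M) = (=)" "le (Idl_magma M) = (\<subseteq>)"
  unfolding Idl_magma_def by simp_all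

section \<open>The product of ideals\<close>

context
  fixes M :: "'a omagma" (structure)
  assumes M: "multiplicative_semilattice M"
begin

interpretation multiplicative_semilattice M by (fact M)

lemma order_idealsD:
  assumes "I \<in> order_ideals M"
  shows "I \<subseteq> carrier M" "I \<noteq> {}" "\<And>x y. \<lbrakk>x \<in> I; y \<in> I\<rbrakk> \<Longrightarrow> x \<squnion> y \<in> I"
    "\<And>x y. \<lbrakk>x \<in> I; y \<in> carrier M; y \<sqsubseteq> x\<rbrakk> \<Longrightarrow> y \<in> I"
  using assms unfolding order_ideals_iff by simp_all

text \<open>For products \<open>x \<cdot> y\<close> and \<open>x' \<cdot> y'\<close>, the product of
  the joins \<open>x \<squnion> x'\<close> and \<open>y \<squnion> y'\<close> is an upper bound that
  stays in the set because each ideal is closed under joins.\<close>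

lemma set_omult_directed:
  assumes I: "I \<in> order_ideals M" and J: "J \<in> order_ideals M"
  shows "directed_subset M (set_omult M I J)"
  unfolding directed_subset_iff
proof (intro conjI ballI)
  note I' = order_idealsD[OF I] and J' = order_idealsD[OF J]
  show "set_omult M I J \<subseteq> carrier M" "set_omult M I J \<noteq> {}"
    using I'(1,2) J'(1,2) unfolding set_omult_def by (auto intro!: omult_closed)
  fix u v assume "u \<in> set_omult M I J" "v \<in> set_omult M I J"
  then obtain x y x' y' where u: "u = x \<cdot> y" "x \<in> I" "y \<in> J" and v: "v = x' \<cdot> y'" "x' \<in> I" "y' \<in> J"
    unfolding set_omult_def by blast
  then have xy: "x \<in> carrier M" "y \<in> carrier M" "x' \<in> carrier M" "y' \<in> carrier M"
    using I'(1) J'(1) by auto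
  have "u \<sqsubseteq> (x \<squnion> x') \<cdot> (y \<squnion> y')" "v \<sqsubseteq> (x \<squnion> x') \<cdot> (y \<squnion> y')"
    unfolding u v using xy by (auto intro!: omult_mono join_left join_right)
  moreover have "(x \<squnion> x') \<cdot> (y \<squnion> y') \<in> set_omult M I J"
    using u v I'(3) J'(3) unfolding set_omult_def by blast
  ultimately show "\<exists>z\<in>set_omult M I J. u \<sqsubseteq> z \<and> v \<sqsubseteq> z" by blast
qed

lemma Idl_omult_ideal:
  assumes I: "I \<in> order_ideals M" and J: "J \<in> order_ideals M"
  shows "I \<cdot>\<^bsub>Idl_magma M\<^esub> J \<in> order_ideals M"
  using set_omult_directed[OF assms] unfolding Idl_magma_def directed_subset_def
  by (simp add: down_set_ideal)

lemma Idl_omult_iff: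
  assumes I: "I \<in> order_ideals M" and J: "J \<in> order_ideals M"
  shows "z \<in> I \<cdot>\<^bsub>Idl_magma M\<^esub> J \<longleftrightarrow> z \<in> carrier M \<and> (\<exists>x\<in>I. \<exists>y\<in>J. z \<sqsubseteq> x \<cdot> y)"
  using down_set_directed[OF set_omult_directed[OF assms]]
  by (auto simp: Idl_magma_def set_omult_def)

text \<open>With \<open>Idl_omult_ideal\<close> and \<open>Idl_omult_mem\<close> this is the
  universal property of the product, namely the least ideal containing all elementwise products.
  Monotonicity of the product follows from it at once.\<close>

lemma Idl_omult_least:
  assumes I: "I \<in> order_ideals M" and J: "J \<in> order_ideals M" and K: "K \<in> order_ideals M"
    and le: "\<And>x y. \<lbrakk>x \<in> I; y \<in> J\<rbrakk> \<Longrightarrow> x \<cdot> y \<in> K"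
  shows "I \<cdot>\<^bsub>Idl_magma M\<^esub> J \<subseteq> K"
  using Idl_omult_iff[OF I J] order_idealsD(4)[OF K] le by fast

lemma Idl_omult_mem:
  assumes I: "I \<in> order_ideals M" and J: "J \<in> order_ideals M" and "x \<in> I" "y \<in> J"
  shows "x \<cdot> y \<in> I \<cdot>\<^bsub>Idl_magma M\<^esub> J"
proof -
  have "x \<cdot> y \<in> carrier M"
    using order_idealsD(1)[OF I] order_idealsD(1)[OF J] assms by (auto intro: omult_closed)
  then show ?thesis
    using assms unfolding Idl_omult_iff[OF I J] by auto
qed

lemma Idl_ordered_magma: "ordered_magma (Idl_magma M)"
proof unfold_locales
  fix I J assume "I \<in> carrier (Idl_magma M)" "J \<in> carrier (Idl_magma M)"
  then show "I \<cdot>\<^bsub>Idl_magma M\<^esub> J \<in> carrier (Idl_magma M)"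
    by (simp add: Idl_omult_ideal)
next
  fix I I' J J'
  assume "I \<in> carrier (Idl_magma M)" "I' \<in> carrier (Idl_magma M)"
    "J \<in> carrier (Idl_magma M)" "J' \<in> carrier (Idl_magma M)"
    "I \<sqsubseteq>\<^bsub>Idl_magma M\<^esub> I'" "J \<sqsubseteq>\<^bsub>Idl_magma M\<^esub> J'"
  then show "I \<cdot>\<^bsub>Idl_magma M\<^esub> J \<sqsubseteq>\<^bsub>Idl_magma M\<^esub> I' \<cdot>\<^bsub>Idl_magma M\<^esub> J'"
    unfolding Idl_simps by (intro Idl_omult_least Idl_omult_ideal Idl_omult_mem) auto
qed auto

section \<open>Suprema of families of ideals and their compatibility with the product\<close>

interpretation Idl: ordered_magma "Idl_magma M" by (fact Idl_ordered_magma)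

text \<open>A nonempty family of ideals has a nonempty union, as ideals are nonempty; the union
  therefore generates an ideal, and an ideal contains every member of the family exactly when it
  contains the generated one.\<close>

lemma Idl_is_lub:
  assumes "\<X> \<subseteq> order_ideals M" "\<X> \<noteq> {}"
  shows "is_lub (Idl_magma M) (down_set M (\<Union>\<X>)) \<X>"
proof -
  have 1: "\<Union>\<X> \<subseteq> carrier M" "\<Union>\<X> \<noteq> {}"
    using assms order_idealsD(1,2) by (blast, fast)
  have 2: "\<And>J. J \<in> order_ideals M \<Longrightarrow> \<forall>I\<in>\<X>. I \<subseteq> J \<Longrightarrow> down_set M (\<Union>\<X>) \<subseteq> J"
    by (rule down_set_least) auto
  have 3: "\<And>I. I \<in> \<X> \<Longrightarrow> I \<subseteq> down_set M (\<Union>\<X>)"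
    using down_set_superset[OF 1(1)] by auto
  show ?thesis
    using assms down_set_ideal[OF 1] 2 3 by (subst is_lub_iff) simp_all
qed

lemma Idl_Sup:
  assumes "\<X> \<subseteq> order_ideals M" "\<X> \<noteq> {}"
  shows "\<Squnion>\<^bsub>Idl_magma M\<^esub>\<X> = down_set M (\<Union>\<X>)"
  by (rule Idl.sup_eqI) (rule Idl_is_lub[OF assms])

lemma Idl_Sup_ideal:
  assumes "\<X> \<subseteq> order_ideals M" "\<X> \<noteq> {}"
  shows "\<Squnion>\<^bsub>Idl_magma M\<^esub>\<X> \<in> order_ideals M"
  using least_closed[OF Idl_is_lub[OF assms]] Idl_Sup[OF assms] by simp

lemma Idl_Sup_least:
  assumes "\<X> \<subseteq> order_ideals M" "\<X> \<noteq> {}" "J \<in> order_ideals M" "\<And>I. I \<in> \<X> \<Longrightarrow> I \<subseteq> J"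
  shows "\<Squnion>\<^bsub>Idl_magma M\<^esub>\<X> \<subseteq> J"
  unfolding Idl_Sup[OF assms(1,2)] using assms by (intro down_set_least) auto

lemma Idl_Sup_upper:
  assumes "\<X> \<subseteq> order_ideals M" "I \<in> \<X>"
  shows "I \<subseteq> \<Squnion>\<^bsub>Idl_magma M\<^esub>\<X>"
proof -
  have "\<Union>\<X> \<subseteq> carrier M" using assms order_idealsD(1) by blast
  from down_set_superset[OF this] show ?thesis
    using assms Idl_Sup[of \<X>] by auto
qed

text \<open>Distributivity of \<open>M\<close> makes the residual \<open>{y. x \<cdot> y \<in> K}\<close> of an ideal an ideal, so that the
  bound on the generators extends to the ideal they generate.\<close>

lemma Idl_omult_Sup_left:
  assumes I: "I \<in> order_ideals M" and X: "\<X> \<subseteq> order_ideals M" "\<X> \<noteq> {}"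
  shows "I \<cdot>\<^bsub>Idl_magma M\<^esub> (\<Squnion>\<^bsub>Idl_magma M\<^esub>\<X>) = \<Squnion>\<^bsub>Idl_magma M\<^esub>((\<lambda>J. I \<cdot>\<^bsub>Idl_magma M\<^esub> J) ` \<X>)"
    (is "?l = \<Squnion>\<^bsub>Idl_magma M\<^esub>?Y")
proof
  have Y: "?Y \<subseteq> order_ideals M" "?Y \<noteq> {}"
    using I X Idl_omult_ideal by auto
  note S = Idl_Sup_ideal[OF X] and K = Idl_Sup_ideal[OF Y]
  show "?l \<subseteq> \<Squnion>\<^bsub>Idl_magma M\<^esub>?Y"
  proof (rule Idl_omult_least[OF I S K])
    fix x y assume x: "x \<in> I" and y: "y \<in> \<Squnion>\<^bsub>Idl_magma M\<^esub>\<X>"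
    define R where "R = {y \<in> carrier M. x \<cdot> y \<in> \<Squnion>\<^bsub>Idl_magma M\<^esub>?Y}"
    have xM: "x \<in> carrier M" using x order_idealsD(1)[OF I] by auto
    have sub: "J \<subseteq> R" if "J \<in> \<X>" for J
    proof
      fix z assume "z \<in> J"
      then have "x \<cdot> z \<in> I \<cdot>\<^bsub>Idl_magma M\<^esub> J"
        using I X x that by (intro Idl_omult_mem) auto
      moreover have "z \<in> carrier M"
        using \<open>z \<in> J\<close> that X order_idealsD(1) by blast
      ultimately show "z \<in> R"
        using Idl_Sup_upper[OF Y(1), of "I \<cdot>\<^bsub>Idl_magma M\<^esub> J"] that unfolding R_def by auto
    qed
    have "R \<in> order_ideals M"
      unfolding order_ideals_iff
    proof (intro conjI ballI impI)
      show "R \<noteq> {}" using sub X order_idealsD(2) by blast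
      show "R \<subseteq> carrier M" unfolding R_def by auto
      show "a \<squnion> b \<in> R" if "a \<in> R" "b \<in> R" for a b
        using that xM order_idealsD(3)[OF K] unfolding R_def by (simp add: omult_join_left)
      show "b \<in> R" if "a \<in> R" "b \<in> carrier M" "b \<sqsubseteq> a" for a b
        using that xM order_idealsD(4)[OF K, of "x \<cdot> a" "x \<cdot> b"] unfolding R_def
        by (simp add: omult_mono omult_closed)
    qed
    then have "\<Squnion>\<^bsub>Idl_magma M\<^esub>\<X> \<subseteq> R"
      using sub by (rule Idl_Sup_least[OF X])
    with y show "x \<cdot> y \<in> \<Squnion>\<^bsub>Idl_magma M\<^esub>?Y" unfolding R_def by auto
  qed
  show "\<Squnion>\<^bsub>Idl_magma M\<^esub>?Y \<subseteq> ?l"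
  proof (rule Idl_Sup_least[OF Y])
    fix K assume "K \<in> ?Y"
    then obtain J where J: "J \<in> \<X>" "K = I \<cdot>\<^bsub>Idl_magma M\<^esub> J" by blast
    with I X S have "I \<cdot>\<^bsub>Idl_magma M\<^esub> J \<sqsubseteq>\<^bsub>Idl_magma M\<^esub> ?l"
      by (intro Idl.omult_mono) (auto dest: Idl_Sup_upper)
    with J show "K \<subseteq> ?l" by simp
  qed (use I S in \<open>simp add: Idl_omult_ideal\<close>)
qed

text \<open>The product is not assumed commutative, so the residual on the other side, consisting of
  the \<open>y\<close> with \<open>y \<cdot> x\<close> in the ideal, is treated in the same way by
  means of \<open>omult_join_right\<close>.\<close>

lemma Idl_omult_Sup_right:
  assumes I: "I \<in> order_ideals M" and X: "\<X> \<subseteq> order_ideals M" "\<X> \<noteq> {}"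
  shows "(\<Squnion>\<^bsub>Idl_magma M\<^esub>\<X>) \<cdot>\<^bsub>Idl_magma M\<^esub> I = \<Squnion>\<^bsub>Idl_magma M\<^esub>((\<lambda>J. J \<cdot>\<^bsub>Idl_magma M\<^esub> I) ` \<X>)"
    (is "?l = \<Squnion>\<^bsub>Idl_magma M\<^esub>?Y")
proof
  have Y: "?Y \<subseteq> order_ideals M" "?Y \<noteq> {}"
    using I X Idl_omult_ideal by auto
  note S = Idl_Sup_ideal[OF X] and K = Idl_Sup_ideal[OF Y]
  show "?l \<subseteq> \<Squnion>\<^bsub>Idl_magma M\<^esub>?Y"
  proof (rule Idl_omult_least[OF S I K])
    fix y x assume x: "x \<in> I" and y: "y \<in> \<Squnion>\<^bsub>Idl_magma M\<^esub>\<X>"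
    define R where "R = {y \<in> carrier M. y \<cdot> x \<in> \<Squnion>\<^bsub>Idl_magma M\<^esub>?Y}"
    have xM: "x \<in> carrier M" using x order_idealsD(1)[OF I] by auto
    have sub: "J \<subseteq> R" if "J \<in> \<X>" for J
    proof
      fix z assume "z \<in> J"
      then have "z \<cdot> x \<in> J \<cdot>\<^bsub>Idl_magma M\<^esub> I"
        using I X x that by (intro Idl_omult_mem) auto
      moreover have "z \<in> carrier M"
        using \<open>z \<in> J\<close> that X order_idealsD(1) by blast
      ultimately show "z \<in> R"
        using Idl_Sup_upper[OF Y(1), of "J \<cdot>\<^bsub>Idl_magma M\<^esub> I"] that unfolding R_def by auto
    qed
    have "R \<in> order_ideals M"
      unfolding order_ideals_iff
    proof (intro conjI ballI impI)
      show "R \<noteq> {}" using sub X order_idealsD(2) by blast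
      show "R \<subseteq> carrier M" unfolding R_def by auto
      show "a \<squnion> b \<in> R" if "a \<in> R" "b \<in> R" for a b
        using that xM order_idealsD(3)[OF K] unfolding R_def by (simp add: omult_join_right)
      show "b \<in> R" if "a \<in> R" "b \<in> carrier M" "b \<sqsubseteq> a" for a b
        using that xM order_idealsD(4)[OF K, of "a \<cdot> x" "b \<cdot> x"] unfolding R_def
        by (simp add: omult_mono omult_closed)
    qed
    then have "\<Squnion>\<^bsub>Idl_magma M\<^esub>\<X> \<subseteq> R"
      using sub by (rule Idl_Sup_least[OF X])
    with y show "y \<cdot> x \<in> \<Squnion>\<^bsub>Idl_magma M\<^esub>?Y" unfolding R_def by auto
  qed
  show "\<Squnion>\<^bsub>Idl_magma M\<^esub>?Y \<subseteq> ?l"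
  proof (rule Idl_Sup_least[OF Y])
    fix K assume "K \<in> ?Y"
    then obtain J where J: "J \<in> \<X>" "K = J \<cdot>\<^bsub>Idl_magma M\<^esub> I" by blast
    with I X S have "J \<cdot>\<^bsub>Idl_magma M\<^esub> I \<sqsubseteq>\<^bsub>Idl_magma M\<^esub> ?l"
      by (intro Idl.omult_mono) (auto dest: Idl_Sup_upper)
    with J show "K \<subseteq> ?l" by simp
  qed (use I S in \<open>simp add: Idl_omult_ideal\<close>)
qed

lemma Idl_near_prequantale: "near_prequantale (Idl_magma M)"
  by unfold_locales
    (auto simp: Idl_omult_Sup_left Idl_omult_Sup_right dest: Idl_is_lub)

section \<open>Directed unions, principal ideals and compactness\<close>

lemma down_elem_subset_iff:
  assumes "I \<in> order_ideals M" "x \<in> carrier M"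
  shows "down_elem M x \<subseteq> I \<longleftrightarrow> x \<in> I"
  using order_idealsD(4)[OF assms(1)] assms(2) unfolding down_elem_def by auto

text \<open>Two elements of the union lie in two members of the family, hence both in a common
  larger member, and that member contains their join.\<close>

lemma Idl_Union_directed:
  assumes "directed_subset (Idl_magma M) \<D>"
  shows "\<Union>\<D> \<in> order_ideals M"
  unfolding order_ideals_iff
proof (intro conjI ballI impI)
  from assms have D: "\<D> \<subseteq> order_ideals M" "\<D> \<noteq> {}"
    and dir: "\<And>I J. \<lbrakk>I \<in> \<D>; J \<in> \<D>\<rbrakk> \<Longrightarrow> \<exists>K\<in>\<D>. I \<subseteq> K \<and> J \<subseteq> K"
    unfolding Idl.directed_subset_iff by simp_all
  show "\<Union>\<D> \<subseteq> carrier M" "\<Union>\<D> \<noteq> {}"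
    using D order_idealsD(1,2) by (blast, fast)
  show "x \<squnion> y \<in> \<Union>\<D>" if xy: "x \<in> \<Union>\<D>" "y \<in> \<Union>\<D>" for x y
  proof -
    obtain I J where "I \<in> \<D>" "x \<in> I" "J \<in> \<D>" "y \<in> J"
      using xy by auto
    with dir obtain K where K: "K \<in> \<D>" "x \<in> K" "y \<in> K"
      by (metis subsetD)
    then have "x \<squnion> y \<in> K"
      using D by (intro order_idealsD(3)) auto
    with K show ?thesis by blast
  qed
  show "y \<in> \<Union>\<D>" if "x \<in> \<Union>\<D>" "y \<in> carrier M" "y \<sqsubseteq> x" for x y
  proof -
    obtain I where I: "I \<in> \<D>" "x \<in> I" using \<open>x \<in> \<Union>\<D>\<close> by blast
    with D have "I \<in> order_ideals M" by blast
    with I that show ?thesis using order_idealsD(4)[of I x y] by blast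
  qed
qed

text \<open>The supremum is the ideal generated by the union, and generation adds nothing to a set
  that is already an ideal.\<close>

lemma Idl_lub_directed:
  assumes D: "directed_subset (Idl_magma M) \<D>" and S: "is_lub (Idl_magma M) S \<D>"
  shows "S = \<Union>\<D>"
proof -
  have sub: "\<D> \<subseteq> order_ideals M" "\<D> \<noteq> {}"
    using D unfolding directed_subset_def by auto
  have "\<Union>\<D> \<subseteq> carrier M"
    using sub order_idealsD(1) by blast
  then have "down_set M (\<Union>\<D>) = \<Union>\<D>"
    using Idl_Union_directed[OF D] down_set_least down_set_superset by blast
  then show ?thesis
    using Idl_is_lub[OF sub] Idl.least_unique[OF S] by simp
qed

lemma Idl_directed_down_elem:
  assumes I: "I \<in> order_ideals M"
  shows "directed_subset (Idl_magma M) (down_elem M ` I)"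
  unfolding Idl.directed_subset_iff
proof (intro conjI ballI)
  note I' = order_idealsD[OF I]
  show "down_elem M ` I \<subseteq> carrier (Idl_magma M)" "down_elem M ` I \<noteq> {}"
    using I'(1,2) down_elem_ideal by auto
  fix A B assume "A \<in> down_elem M ` I" "B \<in> down_elem M ` I"
  then obtain x y where xy: "A = down_elem M x" "x \<in> I" "B = down_elem M y" "y \<in> I" by blast
  then have xyM: "x \<in> carrier M" "y \<in> carrier M"
    using I'(1) by auto
  then have "x \<in> down_elem M (x \<squnion> y)" "y \<in> down_elem M (x \<squnion> y)" "x \<squnion> y \<in> carrier M"
    by (simp_all add: down_elem_def join_left join_right)
  then have "A \<subseteq> down_elem M (x \<squnion> y)" "B \<subseteq> down_elem M (x \<squnion> y)"
    unfolding xy using xyM by (simp_all add: down_elem_subset_iff down_elem_ideal)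
  then show "\<exists>z\<in>down_elem M ` I. A \<sqsubseteq>\<^bsub>Idl_magma M\<^esub> z \<and> B \<sqsubseteq>\<^bsub>Idl_magma M\<^esub> z"
    using I'(3) xy by auto
qed

text \<open>This family of principal ideals serves twice: it is the directed family against which
  compactness of an ideal is tested, and it shows that the compact elements generate
  \<open>Idl_magma M\<close>.\<close>

lemma Idl_lub_down_elem:
  assumes I: "I \<in> order_ideals M"
  shows "is_lub (Idl_magma M) I (down_elem M ` I)"
proof -
  note IM = order_idealsD(1)[OF I]
  have sub: "down_elem M ` I \<subseteq> order_ideals M"
    using IM down_elem_ideal by auto
  have 1: "down_elem M x \<subseteq> I" if "x \<in> I" for x
    using I IM that by (subst down_elem_subset_iff) auto
  have 2: "I \<subseteq> J" if "J \<in> order_ideals M" "\<forall>x\<in>I. down_elem M x \<subseteq> J" for J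
    using that IM down_elem_subset_iff by blast
  show ?thesis
    using I sub 1 2 by (subst is_lub_iff) simp_all
qed

text \<open>A compact ideal \<open>I\<close> is tested against the principal ideals of its own
  elements, which are directed with supremum \<open>I\<close>; compactness puts \<open>I\<close>
  inside the ideal of a single one of its elements. Conversely, if a principal ideal lies in a
  directed union, its generator lies in one member, and so does the whole principal ideal.\<close>

lemma compacts_Idl: "compacts (Idl_magma M) = down_elem M ` carrier M"
proof
  show "compacts (Idl_magma M) \<subseteq> down_elem M ` carrier M"
  proof
    fix I assume I: "I \<in> compacts (Idl_magma M)"
    then have Ii: "I \<in> order_ideals M" unfolding compacts_def by simp
    have "\<exists>J\<in>down_elem M ` I. I \<subseteq> J"
      using I Idl_directed_down_elem[OF Ii] Idl_lub_down_elem[OF Ii]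
      unfolding compacts_def by simp blast
    then obtain x where x: "x \<in> I" "I \<subseteq> down_elem M x" by blast
    moreover have "x \<in> carrier M" using x order_idealsD(1)[OF Ii] by blast
    ultimately show "I \<in> down_elem M ` carrier M"
      using down_elem_subset_iff[OF Ii] by blast
  qed
  show "down_elem M ` carrier M \<subseteq> compacts (Idl_magma M)"
  proof
    fix I assume "I \<in> down_elem M ` carrier M"
    then obtain x where x: "x \<in> carrier M" "I = down_elem M x" by blast
    have "\<exists>J\<in>\<D>. I \<subseteq> J" if D: "directed_subset (Idl_magma M) \<D>" "is_lub (Idl_magma M) S \<D>" "I \<subseteq> S" for \<D> S
    proof -
      have "x \<in> \<Union>\<D>"
        using x D Idl_lub_directed[OF D(1,2)] Idl_Union_directed[OF D(1)] down_elem_subset_iff by blast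
      moreover have "\<D> \<subseteq> order_ideals M"
        using D(1) unfolding directed_subset_def by auto
      ultimately show ?thesis
        using x down_elem_subset_iff by blast
    qed
    then show "I \<in> compacts (Idl_magma M)"
      unfolding compacts_def using x by (auto simp: down_elem_ideal)
  qed
qed

text \<open>The generator \<open>x \<cdot> y\<close> lies in the product ideal, and monotonicity
  keeps every other product below it. The identity gives both the closure of compact ideals under
  multiplication and the homomorphism property of \<open>down_elem M\<close>.\<close>

lemma down_elem_omult:
  assumes x: "x \<in> carrier M" and y: "y \<in> carrier M"
  shows "down_elem M (x \<cdot> y) = down_elem M x \<cdot>\<^bsub>Idl_magma M\<^esub> down_elem M y"
proof
  note i = down_elem_ideal[OF x] down_elem_ideal[OF y]
    and xy = omult_closed[OF x y]
  have mem: "z \<in> down_elem M z" if "z \<in> carrier M" for z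
    using that unfolding down_elem_def by simp
  show "down_elem M (x \<cdot> y) \<subseteq> down_elem M x \<cdot>\<^bsub>Idl_magma M\<^esub> down_elem M y"
    unfolding down_elem_subset_iff[OF Idl_omult_ideal[OF i] xy]
    using x y by (intro Idl_omult_mem[OF i] mem)
  show "down_elem M x \<cdot>\<^bsub>Idl_magma M\<^esub> down_elem M y \<subseteq> down_elem M (x \<cdot> y)"
    using x y by (intro Idl_omult_least[OF i down_elem_ideal[OF xy]])
      (auto simp: down_elem_def intro!: omult_closed omult_mono)
qed

lemma Idl_precoherent_near_prequantale: "precoherent_near_prequantale (Idl_magma M)"
proof -
  have "precoherent (Idl_magma M)"
  proof unfold_locales
    fix I assume "I \<in> carrier (Idl_magma M)"
    then show "\<exists>X. X \<subseteq> compacts (Idl_magma M) \<and> is_lub (Idl_magma M) I X"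
      unfolding compacts_Idl using order_idealsD(1)[of I]
      by (intro exI[of _ "down_elem M ` I"]) (auto intro: Idl_lub_down_elem)
  next
    fix I J assume "I \<in> compacts (Idl_magma M)" "J \<in> compacts (Idl_magma M)"
    then show "I \<cdot>\<^bsub>Idl_magma M\<^esub> J \<in> compacts (Idl_magma M)"
      unfolding compacts_Idl by (auto simp: down_elem_omult[symmetric] intro!: imageI omult_closed)
  qed
  then show ?thesis
    by (intro precoherent_near_prequantale.intro Idl_near_prequantale)
qed

end

section \<open>The semilattice of compact elements\<close>

lemma K_simps [simp]:
  "carrier (K_magma Q) = compacts Q" "eq (K_magma Q) = eq Q" "le (K_magma Q) = le Q"
  "omult (K_magma Q) = omult Q"
  unfolding K_magma_def by simp_all

definition compacts_below :: "('a, 'c) gorder_scheme \<Rightarrow> 'a \<Rightarrow> 'a set" where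
  "compacts_below S x = {k \<in> compacts S. k \<sqsubseteq>\<^bsub>S\<^esub> x}"

lemma compacts_below_le: "k \<in> compacts_below S x \<Longrightarrow> k \<sqsubseteq>\<^bsub>S\<^esub> x"
  by (simp add: compacts_below_def)

lemma compacts_carrier: "compacts S \<subseteq> carrier S"
  unfolding compacts_def by auto

context
  fixes Q :: "'a omagma" (structure)
  assumes Q: "precoherent_near_prequantale Q"
begin

interpretation precoherent_near_prequantale Q by (fact Q)

text \<open>Directed sets are nonempty, so in a near prequantale their suprema exist and compactness
  can be applied to \<open>\<Squnion>D\<close> directly.\<close>

lemma compacts_le_directed_Sup:
  assumes "k \<in> compacts Q" "directed_subset Q D" "k \<sqsubseteq> \<Squnion>D"
  shows "\<exists>y\<in>D. k \<sqsubseteq> y"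
proof -
  have "is_lub Q (\<Squnion>D) D"
    using assms(2) unfolding directed_subset_def by (simp add: Sup_is_lub)
  with assms show ?thesis
    unfolding compacts_def by (simp, metis)
qed

text \<open>Compactness gives, for each \<open>a\<close> in \<open>A\<close>, a member
  \<open>h a\<close> of the directed set above it. As \<open>A\<close> is finite, the chosen members
  have a common upper bound in the directed set, which then lies above
  \<open>\<Squnion>A\<close>.\<close>

lemma compacts_finite_Sup:
  assumes A: "A \<subseteq> compacts Q" "finite A" "A \<noteq> {}"
  shows "\<Squnion>A \<in> compacts Q"
proof -
  have AQ: "A \<subseteq> carrier Q"
    using A compacts_carrier[of Q] by blast
  have "\<exists>y\<in>D. \<Squnion>A \<sqsubseteq> y" if D: "directed_subset Q D" and s: "is_lub Q s D" "\<Squnion>A \<sqsubseteq> s" for D s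
  proof -
    have "\<exists>y\<in>D. a \<sqsubseteq> y" if "a \<in> A" for a
    proof (rule compacts_le_directed_Sup[OF _ D])
      show "a \<in> compacts Q" using A that by blast
      have "a \<sqsubseteq> s"
        using le_trans[OF Sup_upper[OF AQ that] s(2) _ Sup_closed[OF AQ A(3)] least_closed[OF s(1)]]
          AQ that by blast
      then show "a \<sqsubseteq> \<Squnion>D"
        using sup_eqI[OF s(1)] by simp
    qed
    then obtain h where h: "\<And>a. a \<in> A \<Longrightarrow> h a \<in> D \<and> a \<sqsubseteq> h a" by metis
    then have "h ` A \<subseteq> D \<and> finite (h ` A)" using A by auto
    then have "\<exists>d\<in>D. \<forall>x\<in>h ` A. x \<sqsubseteq> d" using D unfolding directed_subset_def by metis
    then obtain d where d: "d \<in> D" "\<And>a. a \<in> A \<Longrightarrow> h a \<sqsubseteq> d" by auto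
    have DQ: "D \<subseteq> carrier Q" using D unfolding directed_subset_def by simp
    have "a \<sqsubseteq> d" if "a \<in> A" for a
      using le_trans[of a "h a" d] h[OF that] d(2)[OF that] subsetD[OF DQ] subsetD[OF AQ that] d(1)
      by simp
    then have "\<Squnion>A \<sqsubseteq> d"
      using AQ A d DQ by (intro Sup_least) auto
    with d show ?thesis by blast
  qed
  then show ?thesis
    unfolding compacts_def using Sup_closed[OF AQ A(3)] by auto
qed

text \<open>The supremum formed in \<open>Q\<close> is itself compact, and the upper bounds it has
  to lie below in \<open>K_magma Q\<close> are among those in \<open>Q\<close>. Finite suprema of
  compact elements thus agree in the two structures.\<close>

lemma K_is_lub:
  assumes A: "A \<subseteq> compacts Q" "finite A" "A \<noteq> {}"
  shows "is_lub (K_magma Q) (\<Squnion>A) A"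
proof -
  have AQ: "A \<subseteq> carrier Q" using A compacts_carrier[of Q] by blast
  have "y \<in> carrier Q" if "y \<in> compacts Q" for y
    using that compacts_carrier[of Q] by blast
  then show ?thesis
    using A compacts_finite_Sup[OF A] Sup_is_lub[OF AQ A(3)]
    by (subst is_lub_iff) (simp_all add: is_lub_iff[OF AQ])
qed

lemma K_partial_order: "partial_order (K_magma Q)"
proof (intro partial_order.intro partial_order_axioms.intro)
  show "weak_partial_order (K_magma Q)"
    unfolding K_magma_def
    by (rule weak_partial_order_subset[OF weak_partial_order_axioms compacts_carrier])
  show "(.=\<^bsub>K_magma Q\<^esub>) = (=)"
    using eq_is_equal by simp
qed

lemma K_Sup: "\<lbrakk>A \<subseteq> compacts Q; finite A; A \<noteq> {}\<rbrakk> \<Longrightarrow> \<Squnion>\<^bsub>K_magma Q\<^esub>A = \<Squnion>A"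
  using partial_order.sup_eqI[OF K_partial_order] K_is_lub by blast

lemma K_join: "\<lbrakk>a \<in> compacts Q; b \<in> compacts Q\<rbrakk> \<Longrightarrow> a \<squnion>\<^bsub>K_magma Q\<^esub> b = a \<squnion> b"
  unfolding join_def by (simp add: K_Sup)

text \<open>Joins of compact elements are computed in \<open>Q\<close>, and the two distributive
  laws are those of \<open>Q\<close> for the set \<open>{x, y}\<close>.\<close>

lemma K_multiplicative_semilattice: "multiplicative_semilattice (K_magma Q)"
proof -
  have K: "x \<in> carrier Q" if "x \<in> compacts Q" for x
    using that compacts_carrier[of Q] by blast
  interpret K: partial_order "K_magma Q" by (fact K_partial_order)
  show ?thesis
  proof unfold_locales
    fix x y assume "x \<in> carrier (K_magma Q)" "y \<in> carrier (K_magma Q)"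
    then show "x \<cdot>\<^bsub>K_magma Q\<^esub> y \<in> carrier (K_magma Q)"
      "\<exists>s. is_lub (K_magma Q) s {x, y}"
      using K_is_lub[of "{x, y}"] by (simp add: compacts_closed, fastforce)
  next
    fix x x' y y'
    assume "x \<in> carrier (K_magma Q)" "x' \<in> carrier (K_magma Q)" "y \<in> carrier (K_magma Q)"
      "y' \<in> carrier (K_magma Q)" "x \<sqsubseteq>\<^bsub>K_magma Q\<^esub> x'" "y \<sqsubseteq>\<^bsub>K_magma Q\<^esub> y'"
    then show "x \<cdot>\<^bsub>K_magma Q\<^esub> y \<sqsubseteq>\<^bsub>K_magma Q\<^esub> x' \<cdot>\<^bsub>K_magma Q\<^esub> y'"
      by (simp add: K omult_mono)
  next
    fix a x y
    assume "a \<in> carrier (K_magma Q)" "x \<in> carrier (K_magma Q)" "y \<in> carrier (K_magma Q)"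
    then show "a \<cdot>\<^bsub>K_magma Q\<^esub> (x \<squnion>\<^bsub>K_magma Q\<^esub> y) = a \<cdot>\<^bsub>K_magma Q\<^esub> x \<squnion>\<^bsub>K_magma Q\<^esub> a \<cdot>\<^bsub>K_magma Q\<^esub> y"
      and "(x \<squnion>\<^bsub>K_magma Q\<^esub> y) \<cdot>\<^bsub>K_magma Q\<^esub> a = x \<cdot>\<^bsub>K_magma Q\<^esub> a \<squnion>\<^bsub>K_magma Q\<^esub> y \<cdot>\<^bsub>K_magma Q\<^esub> a"
      using omult_Sup_left[of a "{x, y}"] omult_Sup_right[of a "{x, y}"]
      by (simp_all add: K_join compacts_closed K) (simp_all add: join_def)
  qed
qed

section \<open>Elements of Q as ideals of compact elements\<close>

interpretation K: multiplicative_semilattice "K_magma Q" by (fact K_multiplicative_semilattice)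

text \<open>The order on \<open>K_magma Q\<close> is the one of \<open>Q\<close>, so an ideal of
  compact elements is directed in \<open>Q\<close>, although in general not downward closed there.
  Directedness in \<open>Q\<close> gives it a supremum to which compactness applies.\<close>

lemma K_ideal_directed:
  assumes I: "I \<in> order_ideals (K_magma Q)"
  shows "directed_subset Q I" "I \<subseteq> compacts Q" "I \<subseteq> carrier Q" "I \<noteq> {}"
  using I compacts_carrier[of Q] unfolding order_ideals_def directed_subset_def by auto

text \<open>An ideal must be nonempty, but \<open>compactly_generated\<close> may present
  \<open>x\<close> as the supremum of the empty set. In that case \<open>x\<close> is the least
  element and has to be recognized as compact itself.\<close>

lemma compacts_below_nonempty:
  assumes x: "x \<in> carrier Q"
  shows "compacts_below Q x \<noteq> {}"
proof -
  from compactly_generated[OF x] obtain X where X: "X \<subseteq> compacts Q" "is_lub Q x X"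
    by blast
  show ?thesis
  proof (cases "X = {}")
    case True
    then have least: "x \<sqsubseteq> y" if "y \<in> carrier Q" for y
      using X(2) that by (simp add: least_def)
    \<comment> \<open>the least element is compact, as directed sets are nonempty\<close>
    have "\<exists>y\<in>D. x \<sqsubseteq> y" if "directed_subset Q D" for D
    proof -
      from that obtain y where "y \<in> D" "y \<in> carrier Q"
        unfolding directed_subset_def by blast
      with least show ?thesis by blast
    qed
    then have "x \<in> compacts Q"
      unfolding compacts_def using x by simp
    then show ?thesis
      unfolding compacts_below_def using x by auto
  next
    case False
    then obtain k where "k \<in> X" by blast
    then have "k \<sqsubseteq> x"
      using X compacts_carrier[of Q] by (intro least_Upper_above[OF X(2)]) auto
    then show ?thesis
      unfolding compacts_below_def using X \<open>k \<in> X\<close> by blast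
  qed
qed

text \<open>Any set \<open>X\<close> of compact elements with supremum \<open>x\<close> is contained
  in \<open>compacts_below Q x\<close>, so an upper bound of the larger set bounds \<open>X\<close>
  and hence lies above \<open>x\<close>.\<close>

lemma compacts_below_lub:
  assumes x: "x \<in> carrier Q"
  shows "is_lub Q x (compacts_below Q x)"
proof -
  from compactly_generated[OF x] obtain X where X: "X \<subseteq> compacts Q" "is_lub Q x X"
    by blast
  have XQ: "X \<subseteq> carrier Q" using X(1) compacts_carrier[of Q] by blast
  have sub: "compacts_below Q x \<subseteq> carrier Q"
    unfolding compacts_below_def using compacts_carrier[of Q] by blast
  have "X \<subseteq> compacts_below Q x"
    unfolding compacts_below_def using X least_Upper_above[OF X(2) _ XQ] by blast
  with X x show ?thesis
    unfolding is_lub_iff[OF sub] is_lub_iff[OF XQ] by (meson compacts_below_le subsetD)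
qed

lemma compacts_below_ideal:
  assumes x: "x \<in> carrier Q"
  shows "compacts_below Q x \<in> order_ideals (K_magma Q)"
  unfolding K.order_ideals_iff
proof (intro conjI ballI impI)
  have K: "k \<in> carrier Q" if "k \<in> compacts Q" for k
    using that compacts_carrier[of Q] by blast
  show "compacts_below Q x \<noteq> {}" by (rule compacts_below_nonempty[OF x])
  show "compacts_below Q x \<subseteq> carrier (K_magma Q)" unfolding compacts_below_def by auto
  show "a \<squnion>\<^bsub>K_magma Q\<^esub> b \<in> compacts_below Q x" if "a \<in> compacts_below Q x" "b \<in> compacts_below Q x" for a b
    using that x K.join_closed[of a b] unfolding compacts_below_def
    by (auto simp: K_join K) (auto simp: K join_def intro!: Sup_least)
  show "b \<in> compacts_below Q x"
    if "a \<in> compacts_below Q x" "b \<in> carrier (K_magma Q)" "b \<sqsubseteq>\<^bsub>K_magma Q\<^esub> a" for a b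
    using that x K le_trans[of b a x] unfolding compacts_below_def by simp
qed

lemma Sup_compacts_below: "x \<in> carrier Q \<Longrightarrow> \<Squnion>(compacts_below Q x) = x"
  by (rule sup_eqI) (rule compacts_below_lub)

lemma compacts_below_Sup:
  assumes I: "I \<in> order_ideals (K_magma Q)"
  shows "compacts_below Q (\<Squnion>I) = I"
proof
  note I' = K_ideal_directed[OF I]
  show "I \<subseteq> compacts_below Q (\<Squnion>I)"
    unfolding compacts_below_def using I' Sup_upper by blast
  show "compacts_below Q (\<Squnion>I) \<subseteq> I"
  proof
    fix k assume "k \<in> compacts_below Q (\<Squnion>I)"
    then have k: "k \<in> compacts Q" "k \<sqsubseteq> \<Squnion>I" unfolding compacts_below_def by auto
    then obtain y where "y \<in> I" "k \<sqsubseteq> y"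
      using compacts_le_directed_Sup[OF _ I'(1)] by blast
    with k show "k \<in> I" using I unfolding order_ideals_def by auto
  qed
qed

text \<open>If \<open>\<Squnion>I \<sqsubseteq> \<Squnion>J\<close>, then \<open>I\<close> consists
  of compact elements below \<open>\<Squnion>J\<close>, and these make up \<open>J\<close>; so the
  order is reflected. For products, one inequality is \<open>omult_Sup_least\<close>, and the other
  holds because each element of the product ideal lies below some \<open>x \<cdot> y\<close> with
  \<open>x \<in> I\<close> and \<open>y \<in> J\<close>.\<close>

lemma Sup_Idl_K_iso: "omagma_iso (Idl_magma (K_magma Q)) Q (\<lambda>I. \<Squnion>I)"
proof -
  let ?I = "Idl_magma (K_magma Q)"
  note MK = K_multiplicative_semilattice
  interpret I: ordered_magma ?I by (rule Idl_ordered_magma[OF MK])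
  have cl: "\<Squnion>I \<in> carrier Q" if "I \<in> order_ideals (K_magma Q)" for I
    using K_ideal_directed(3,4)[OF that] by (rule Sup_closed)
  have emb: "\<Squnion>I \<sqsubseteq> \<Squnion>J \<longleftrightarrow> I \<subseteq> J"
    if I: "I \<in> order_ideals (K_magma Q)" and J: "J \<in> order_ideals (K_magma Q)" for I J
  proof
    note I' = K_ideal_directed[OF I] and J' = K_ideal_directed[OF J]
    assume le: "\<Squnion>I \<sqsubseteq> \<Squnion>J"
    have "k \<sqsubseteq> \<Squnion>J" if "k \<in> I" for k
      using I'(3) that le_trans[OF Sup_upper[OF I'(3) that] le] cl[OF I] cl[OF J] by auto
    then have "I \<subseteq> compacts_below Q (\<Squnion>J)"
      unfolding compacts_below_def using I' by blast
    then show "I \<subseteq> J" using compacts_below_Sup[OF J] by simp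
  next
    note I' = K_ideal_directed[OF I] and J' = K_ideal_directed[OF J]
    assume "I \<subseteq> J"
    then show "\<Squnion>I \<sqsubseteq> \<Squnion>J"
      using I' J' cl[OF J] by (intro Sup_least Sup_upper) auto
  qed
  have hom: "\<Squnion>(I \<cdot>\<^bsub>?I\<^esub> J) = \<Squnion>I \<cdot> \<Squnion>J"
    if I: "I \<in> order_ideals (K_magma Q)" and J: "J \<in> order_ideals (K_magma Q)" for I J
  proof (rule le_antisym)
    note IJ = Idl_omult_ideal[OF MK I J]
    note I' = K_ideal_directed[OF I] and J' = K_ideal_directed[OF J] and IJ' = K_ideal_directed[OF IJ]
    show "\<Squnion>I \<cdot> \<Squnion>J \<sqsubseteq> \<Squnion>(I \<cdot>\<^bsub>?I\<^esub> J)"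
      using Idl_omult_mem[OF MK I J] by (intro omult_Sup_least Sup_upper I' J' IJ' cl[OF IJ]) simp
    show "\<Squnion>(I \<cdot>\<^bsub>?I\<^esub> J) \<sqsubseteq> \<Squnion>I \<cdot> \<Squnion>J"
    proof (rule Sup_least[OF IJ'(3,4)])
      show "\<Squnion>I \<cdot> \<Squnion>J \<in> carrier Q" using cl I J by (intro omult_closed)
      fix z assume z: "z \<in> I \<cdot>\<^bsub>?I\<^esub> J"
      then obtain x y where xy: "x \<in> I" "y \<in> J" "z \<sqsubseteq> x \<cdot> y"
        unfolding Idl_omult_iff[OF MK I J] by auto
      have xyQ: "x \<in> carrier Q" "y \<in> carrier Q" "z \<in> carrier Q"
        using xy z I'(3) J'(3) IJ'(3) by auto
      have "x \<cdot> y \<sqsubseteq> \<Squnion>I \<cdot> \<Squnion>J"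
        using xy xyQ cl I J by (intro omult_mono Sup_upper I' J')
      with xy xyQ show "z \<sqsubseteq> \<Squnion>I \<cdot> \<Squnion>J"
        using le_trans[of z "x \<cdot> y" "\<Squnion>I \<cdot> \<Squnion>J"] cl I J by (simp add: omult_closed)
    qed
    show "\<Squnion>(I \<cdot>\<^bsub>?I\<^esub> J) \<in> carrier Q" "\<Squnion>I \<cdot> \<Squnion>J \<in> carrier Q"
      using cl I J IJ by (auto intro: omult_closed)
  qed
  have "bij_betw (\<lambda>I. \<Squnion>I) (carrier ?I) (carrier Q)"
    by (rule bij_betw_byWitness[of _ "compacts_below Q"])
      (auto simp: compacts_below_Sup Sup_compacts_below Q cl compacts_below_ideal)
  then show ?thesis
    unfolding omagma_iso_def magma_hom_def order_emb_def
    using cl emb hom I.ordered_magma_axioms I.weak_partial_order_axioms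
      ordered_magma_axioms weak_partial_order_axioms by auto
qed

end

lemma down_elem_iso:
  assumes M: "multiplicative_semilattice M"
  shows "omagma_iso M (K_magma (Idl_magma M)) (\<lambda>x. down_elem M x)"
proof -
  interpret multiplicative_semilattice M by (fact M)
  interpret K: multiplicative_semilattice "K_magma (Idl_magma M)"
    by (intro K_multiplicative_semilattice Idl_precoherent_near_prequantale M)
  have emb: "down_elem M x \<subseteq> down_elem M y \<longleftrightarrow> x \<sqsubseteq>\<^bsub>M\<^esub> y" if "x \<in> carrier M" "y \<in> carrier M" for x y
    using that down_elem_subset_iff[OF M down_elem_ideal[of y], of x] by (simp add: down_elem_def)
  have "inj_on (down_elem M) (carrier M)"
    using emb le_antisym by (intro inj_onI) (metis order_refl)
  then have "bij_betw (down_elem M) (carrier M) (carrier (K_magma (Idl_magma M)))"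
    by (simp add: bij_betw_def compacts_Idl[OF M])
  then show ?thesis
    unfolding omagma_iso_def magma_hom_def order_emb_def
    using emb down_elem_omult[OF M] ordered_magma_axioms weak_partial_order_axioms
      K.ordered_magma_axioms K.weak_partial_order_axioms by (auto simp: compacts_Idl[OF M])
qed

section \<open>Morphisms\<close>

lemma mult_semilattice_morD:
  assumes "mult_semilattice_mor M N g"
  shows "multiplicative_semilattice M" "multiplicative_semilattice N" "g \<in> carrier M \<rightarrow> carrier N"
    "\<And>x y. \<lbrakk>x \<in> carrier M; y \<in> carrier M\<rbrakk> \<Longrightarrow> g (x \<cdot>\<^bsub>M\<^esub> y) = g x \<cdot>\<^bsub>N\<^esub> g y"
    "\<And>X. \<lbrakk>X \<subseteq> carrier M; finite X; X \<noteq> {}\<rbrakk> \<Longrightarrow> g (\<Squnion>\<^bsub>M\<^esub>X) = \<Squnion>\<^bsub>N\<^esub>(g ` X)"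
  using assms unfolding mult_semilattice_mor_def magma_hom_def by auto

lemma mult_semilattice_morI:
  assumes "multiplicative_semilattice M" "multiplicative_semilattice N" "g \<in> carrier M \<rightarrow> carrier N"
    "\<And>x y. \<lbrakk>x \<in> carrier M; y \<in> carrier M\<rbrakk> \<Longrightarrow> g (x \<cdot>\<^bsub>M\<^esub> y) = g x \<cdot>\<^bsub>N\<^esub> g y"
    "\<And>X. \<lbrakk>X \<subseteq> carrier M; finite X; X \<noteq> {}\<rbrakk> \<Longrightarrow> g (\<Squnion>\<^bsub>M\<^esub>X) = \<Squnion>\<^bsub>N\<^esub>(g ` X)"
  shows "mult_semilattice_mor M N g"
  using assms unfolding mult_semilattice_mor_def magma_hom_def by auto

lemma mult_semilattice_mor_compose:
  assumes f: "mult_semilattice_mor M N f" and g: "mult_semilattice_mor N P g"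
  shows "mult_semilattice_mor M P (compose (carrier M) g f)"
proof -
  note f' = mult_semilattice_morD[OF f] and g' = mult_semilattice_morD[OF g]
  interpret M: multiplicative_semilattice M by (fact f'(1))
  show ?thesis
  proof (rule mult_semilattice_morI[OF f'(1) g'(2)])
    show "compose (carrier M) g f \<in> carrier M \<rightarrow> carrier P"
      using f'(3) g'(3) by (auto simp: compose_def)
    fix x y assume xy: "x \<in> carrier M" "y \<in> carrier M"
    then have "f x \<in> carrier N" "f y \<in> carrier N" using f'(3) by auto
    with xy show "compose (carrier M) g f (x \<cdot>\<^bsub>M\<^esub> y) =
        compose (carrier M) g f x \<cdot>\<^bsub>P\<^esub> compose (carrier M) g f y"
      by (simp add: compose_def M.omult_closed f'(4) g'(4))
  next
    fix X assume X: "X \<subseteq> carrier M" "finite X" "X \<noteq> {}"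
    then have "f ` X \<subseteq> carrier N" "f ` X \<noteq> {}" "finite (f ` X)" using f'(3) by auto
    moreover have "compose (carrier M) g f ` X = g ` f ` X"
      unfolding image_image using X by (intro image_cong) (auto simp: compose_def)
    ultimately show "compose (carrier M) g f (\<Squnion>\<^bsub>M\<^esub>X) = \<Squnion>\<^bsub>P\<^esub>(compose (carrier M) g f ` X)"
      using X by (simp add: compose_def f'(5) g'(5))
  qed
qed

text \<open>Monotonicity is a consequence of the preservation of suprema, since the supremum of
  \<open>{x, y}\<close> is \<open>y\<close> when \<open>x\<close> lies below
  \<open>y\<close>.\<close>

lemma mult_semilattice_mor_mono:
  assumes g: "mult_semilattice_mor M N g" and xy: "x \<in> carrier M" "y \<in> carrier M" "x \<sqsubseteq>\<^bsub>M\<^esub> y"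
  shows "g x \<sqsubseteq>\<^bsub>N\<^esub> g y"
proof -
  from g interpret M: multiplicative_semilattice M + N: multiplicative_semilattice N
    unfolding mult_semilattice_mor_def by blast+
  have gN: "g x \<in> carrier N" "g y \<in> carrier N"
    using g xy unfolding mult_semilattice_mor_def magma_hom_def by auto
  have "g y = g (\<Squnion>\<^bsub>M\<^esub>{x, y})"
    using M.sup_eqI[OF M.is_lub_pair[OF xy(3,1,2)]] by simp
  also have "\<dots> = \<Squnion>\<^bsub>N\<^esub>(g ` {x, y})"
    using xy by (intro mult_semilattice_morD(5)[OF g]) auto
  also have "\<dots> = g x \<squnion>\<^bsub>N\<^esub> g y"
    by (simp add: join_def)
  finally show ?thesis
    using N.join_left[OF gN] by simp
qed

lemma mult_semilattice_mor_join:
  assumes g: "mult_semilattice_mor M N g" and xy: "x \<in> carrier M" "y \<in> carrier M"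
  shows "g (x \<squnion>\<^bsub>M\<^esub> y) = g x \<squnion>\<^bsub>N\<^esub> g y"
proof -
  have "g (\<Squnion>\<^bsub>M\<^esub>{x, y}) = \<Squnion>\<^bsub>N\<^esub>(g ` {x, y})"
    using xy by (intro mult_semilattice_morD(5)[OF g]) auto
  then show ?thesis by (simp add: join_def)
qed

lemma near_prequantale_mor_mono:
  assumes f: "near_prequantale_mor Q R f" and xy: "x \<in> carrier Q" "y \<in> carrier Q" "x \<sqsubseteq>\<^bsub>Q\<^esub> y"
  shows "f x \<sqsubseteq>\<^bsub>R\<^esub> f y"
proof -
  from f interpret Q: near_prequantale Q + R: near_prequantale R
    unfolding near_prequantale_mor_def by blast+
  have fR: "{f x, f y} \<subseteq> carrier R"
    using f xy unfolding near_prequantale_mor_def magma_hom_def by auto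
  have "f y = f (\<Squnion>\<^bsub>Q\<^esub>{x, y})"
    using Q.sup_eqI[OF Q.is_lub_pair[OF xy(3,1,2)]] by simp
  also have "\<dots> = \<Squnion>\<^bsub>R\<^esub>(f ` {x, y})"
    using f xy unfolding near_prequantale_mor_def by simp
  finally show ?thesis
    using R.Sup_upper[OF fR, of "f x"] by simp
qed

lemma precoherent_morD:
  assumes "precoherent_mor Q R f"
  shows "precoherent_near_prequantale Q" "precoherent_near_prequantale R"
    "f \<in> carrier Q \<rightarrow> carrier R" "f \<in> compacts Q \<rightarrow> compacts R"
    "\<And>x y. \<lbrakk>x \<in> carrier Q; y \<in> carrier Q\<rbrakk> \<Longrightarrow> f (x \<cdot>\<^bsub>Q\<^esub> y) = f x \<cdot>\<^bsub>R\<^esub> f y"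
    "\<And>X. \<lbrakk>X \<subseteq> carrier Q; X \<noteq> {}\<rbrakk> \<Longrightarrow> f (\<Squnion>\<^bsub>Q\<^esub>X) = \<Squnion>\<^bsub>R\<^esub>(f ` X)"
    "\<And>x y. \<lbrakk>x \<in> carrier Q; y \<in> carrier Q; x \<sqsubseteq>\<^bsub>Q\<^esub> y\<rbrakk> \<Longrightarrow> f x \<sqsubseteq>\<^bsub>R\<^esub> f y"
  using assms near_prequantale_mor_mono[of Q R f]
  unfolding precoherent_mor_def near_prequantale_mor_def magma_hom_def
  by (auto intro: precoherent_near_prequantale.intro)

lemma precoherent_morI:
  assumes "precoherent_near_prequantale Q" "precoherent_near_prequantale R"
    and "f \<in> carrier Q \<rightarrow> carrier R" "f \<in> compacts Q \<rightarrow> compacts R"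
    and "\<And>x y. \<lbrakk>x \<in> carrier Q; y \<in> carrier Q\<rbrakk> \<Longrightarrow> f (x \<cdot>\<^bsub>Q\<^esub> y) = f x \<cdot>\<^bsub>R\<^esub> f y"
    and "\<And>X. \<lbrakk>X \<subseteq> carrier Q; X \<noteq> {}\<rbrakk> \<Longrightarrow> f (\<Squnion>\<^bsub>Q\<^esub>X) = \<Squnion>\<^bsub>R\<^esub>(f ` X)"
  shows "precoherent_mor Q R f"
  using assms unfolding precoherent_mor_def near_prequantale_mor_def magma_hom_def
    precoherent_near_prequantale_def by auto

text \<open>By \<open>K_Sup\<close> finite suprema of compact elements are the same in
  \<open>K_magma Q\<close> and in \<open>Q\<close>, so their preservation is inherited from
  \<open>f\<close>. As \<open>K_map\<close> agrees with \<open>f\<close> on compact elements only,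
  products and suprema must be known to be compact before it can be evaluated.\<close>

lemma K_map_mor:
  assumes f: "precoherent_mor Q R f"
  shows "mult_semilattice_mor (K_magma Q) (K_magma R) (K_map Q f)"
proof -
  note Q = precoherent_morD(1)[OF f] and R = precoherent_morD(2)[OF f]
  note KQ = K_multiplicative_semilattice[OF Q] and KR = K_multiplicative_semilattice[OF R]
  interpret KQ: multiplicative_semilattice "K_magma Q" by (fact KQ)
  have K: "x \<in> carrier Q" if "x \<in> compacts Q" for x
    using that compacts_carrier[of Q] by blast
  show ?thesis
  proof (rule mult_semilattice_morI[OF KQ KR])
    show "K_map Q f \<in> carrier (K_magma Q) \<rightarrow> carrier (K_magma R)"
      using precoherent_morD(4)[OF f] by (auto simp: K_map_def)
  next
    fix x y assume "x \<in> carrier (K_magma Q)" "y \<in> carrier (K_magma Q)"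
    then show "K_map Q f (x \<cdot>\<^bsub>K_magma Q\<^esub> y) = K_map Q f x \<cdot>\<^bsub>K_magma R\<^esub> K_map Q f y"
      using KQ.omult_closed[of x y] precoherent_morD(5)[OF f K K, of x y] by (simp add: K_map_def)
  next
    fix X assume X: "X \<subseteq> carrier (K_magma Q)" "finite X" "X \<noteq> {}"
    then have im: "K_map Q f ` X = f ` X"
      by (auto simp: K_map_def intro!: image_cong)
    have "\<Squnion>\<^bsub>K_magma R\<^esub>(f ` X) = \<Squnion>\<^bsub>R\<^esub>(f ` X)"
      using X precoherent_morD(4)[OF f] by (intro K_Sup[OF R]) auto
    also have "\<dots> = f (\<Squnion>\<^bsub>Q\<^esub>X)"
      using X K by (intro precoherent_morD(6)[OF f, symmetric]) auto
    also have "\<dots> = K_map Q f (\<Squnion>\<^bsub>K_magma Q\<^esub>X)"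
      using X K_Sup[OF Q, of X] compacts_finite_Sup[OF Q, of X] by (simp add: K_map_def)
    finally show "K_map Q f (\<Squnion>\<^bsub>K_magma Q\<^esub>X) = \<Squnion>\<^bsub>K_magma R\<^esub>(K_map Q f ` X)"
      by (simp add: im)
  qed
qed

section \<open>The action of \<open>Idl\<close> on morphisms\<close>

context
  fixes M :: "'a omagma" and N :: "'b omagma" and g
  assumes g: "mult_semilattice_mor M N g"
begin

interpretation M: multiplicative_semilattice M by (rule mult_semilattice_morD(1)[OF g])
interpretation N: multiplicative_semilattice N by (rule mult_semilattice_morD(2)[OF g])

text \<open>By monotonicity the image of a join lies above the images of both elements.
  \<open>Idl_map\<close> therefore reduces to a downward closure, as recorded in
  \<open>Idl_map_iff\<close>.\<close>

lemma image_directed: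
  assumes I: "I \<in> order_ideals M"
  shows "directed_subset N (g ` I)"
  unfolding N.directed_subset_iff
proof (intro conjI ballI)
  note I' = order_idealsD[OF M.multiplicative_semilattice_axioms I]
  show "g ` I \<subseteq> carrier N" "g ` I \<noteq> {}"
    using I'(1,2) mult_semilattice_morD(3)[OF g] by auto
  fix u v assume "u \<in> g ` I" "v \<in> g ` I"
  then obtain x y where xy: "u = g x" "v = g y" "x \<in> I" "y \<in> I" by blast
  then have "x \<in> carrier M" "y \<in> carrier M" using I'(1) by auto
  then have "u \<sqsubseteq>\<^bsub>N\<^esub> g (x \<squnion>\<^bsub>M\<^esub> y)" "v \<sqsubseteq>\<^bsub>N\<^esub> g (x \<squnion>\<^bsub>M\<^esub> y)"
    unfolding xy by (auto intro!: mult_semilattice_mor_mono[OF g] M.join_left M.join_right)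
  with I'(3) xy show "\<exists>z\<in>g ` I. u \<sqsubseteq>\<^bsub>N\<^esub> z \<and> v \<sqsubseteq>\<^bsub>N\<^esub> z" by blast
qed

lemma Idl_map_ideal: "I \<in> order_ideals M \<Longrightarrow> Idl_map M N g I \<in> order_ideals N"
  using image_directed[of I] unfolding Idl_map_def directed_subset_def
  by (simp add: N.down_set_ideal)

lemma Idl_map_iff:
  assumes I: "I \<in> order_ideals M"
  shows "z \<in> Idl_map M N g I \<longleftrightarrow> z \<in> carrier N \<and> (\<exists>x\<in>I. z \<sqsubseteq>\<^bsub>N\<^esub> g x)"
  using N.down_set_directed[OF image_directed[OF I]] I by (auto simp: Idl_map_def)

lemma Idl_map_mem:
  assumes I: "I \<in> order_ideals M" and x: "x \<in> I"
  shows "g x \<in> Idl_map M N g I"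
proof -
  have "g x \<in> carrier N"
    using image_directed[OF I] x unfolding directed_subset_def by blast
  with x show ?thesis unfolding Idl_map_iff[OF I] by auto
qed

lemma Idl_map_least:
  assumes I: "I \<in> order_ideals M" and J: "J \<in> order_ideals N" and "\<And>x. x \<in> I \<Longrightarrow> g x \<in> J"
  shows "Idl_map M N g I \<subseteq> J"
proof -
  have "g ` I \<subseteq> J" using assms(3) by blast
  then show ?thesis using I N.down_set_least[OF J] by (simp add: Idl_map_def)
qed

text \<open>The formula serves twice: \<open>Idl_map\<close> sends compact elements to compact
  elements, and the isomorphism given by \<open>down_elem\<close> is natural.\<close>

lemma Idl_map_down_elem:
  assumes x: "x \<in> carrier M"
  shows "Idl_map M N g (down_elem M x) = down_elem N (g x)"
proof
  note i = M.down_elem_ideal[OF x]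
  have gx: "g x \<in> carrier N" using mult_semilattice_morD(3)[OF g] x by blast
  show "Idl_map M N g (down_elem M x) \<subseteq> down_elem N (g x)"
    using x mult_semilattice_mor_mono[OF g _ x] mult_semilattice_morD(3)[OF g]
    by (intro Idl_map_least i N.down_elem_ideal gx) (auto simp: down_elem_def)
  show "down_elem N (g x) \<subseteq> Idl_map M N g (down_elem M x)"
    unfolding down_elem_subset_iff[OF N.multiplicative_semilattice_axioms Idl_map_ideal[OF i] gx]
    using x by (intro Idl_map_mem[OF i]) (simp add: down_elem_def)
qed

lemma Idl_map_mor: "precoherent_mor (Idl_magma M) (Idl_magma N) (Idl_map M N g)"
proof -
  note M = M.multiplicative_semilattice_axioms and N = N.multiplicative_semilattice_axioms
  show ?thesis
  proof (rule precoherent_morI)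
    show "precoherent_near_prequantale (Idl_magma M)" "precoherent_near_prequantale (Idl_magma N)"
      by (rule Idl_precoherent_near_prequantale, fact)+
    show "Idl_map M N g \<in> carrier (Idl_magma M) \<rightarrow> carrier (Idl_magma N)"
      by (simp add: Idl_map_ideal)
    show "Idl_map M N g \<in> compacts (Idl_magma M) \<rightarrow> compacts (Idl_magma N)"
      using mult_semilattice_morD(3)[OF g]
      by (auto simp: compacts_Idl[OF M] compacts_Idl[OF N] Idl_map_down_elem)
  next
    fix I J assume "I \<in> carrier (Idl_magma M)" "J \<in> carrier (Idl_magma M)"
    then have I: "I \<in> order_ideals M" and J: "J \<in> order_ideals M" by simp_all
    note IJ = Idl_omult_ideal[OF M I J]
    note gI = Idl_map_ideal[OF I] and gJ = Idl_map_ideal[OF J] and gIJ = Idl_map_ideal[OF IJ]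
    note I' = order_idealsD(1)[OF M I] and J' = order_idealsD(1)[OF M J]
    show "Idl_map M N g (I \<cdot>\<^bsub>Idl_magma M\<^esub> J) = Idl_map M N g I \<cdot>\<^bsub>Idl_magma N\<^esub> Idl_map M N g J"
    proof
      have gxy: "g (x \<cdot>\<^bsub>M\<^esub> y) = g x \<cdot>\<^bsub>N\<^esub> g y" if "x \<in> I" "y \<in> J" for x y
        using that I' J' by (intro mult_semilattice_morD(4)[OF g]) auto
      show "Idl_map M N g (I \<cdot>\<^bsub>Idl_magma M\<^esub> J) \<subseteq> Idl_map M N g I \<cdot>\<^bsub>Idl_magma N\<^esub> Idl_map M N g J"
      proof (rule Idl_map_least[OF IJ Idl_omult_ideal[OF N gI gJ]])
        fix z assume "z \<in> I \<cdot>\<^bsub>Idl_magma M\<^esub> J"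
        then obtain x y where z: "z \<in> carrier M" "x \<in> I" "y \<in> J" "z \<sqsubseteq>\<^bsub>M\<^esub> x \<cdot>\<^bsub>M\<^esub> y"
          unfolding Idl_omult_iff[OF M I J] by auto
        then have "x \<cdot>\<^bsub>M\<^esub> y \<in> carrier M"
          using I' J' by (intro M.omult_closed) auto
        with z have "g z \<sqsubseteq>\<^bsub>N\<^esub> g x \<cdot>\<^bsub>N\<^esub> g y" "g z \<in> carrier N"
          using mult_semilattice_mor_mono[OF g, of z "x \<cdot>\<^bsub>M\<^esub> y"] gxy mult_semilattice_morD(3)[OF g]
          by auto
        with z show "g z \<in> Idl_map M N g I \<cdot>\<^bsub>Idl_magma N\<^esub> Idl_map M N g J"
          unfolding Idl_omult_iff[OF N gI gJ] using Idl_map_mem[OF I] Idl_map_mem[OF J] by blast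
      qed
      show "Idl_map M N g I \<cdot>\<^bsub>Idl_magma N\<^esub> Idl_map M N g J \<subseteq> Idl_map M N g (I \<cdot>\<^bsub>Idl_magma M\<^esub> J)"
      proof (rule Idl_omult_least[OF N gI gJ gIJ])
        fix u v assume "u \<in> Idl_map M N g I" "v \<in> Idl_map M N g J"
        then obtain x y where uv: "x \<in> I" "y \<in> J" "u \<in> carrier N" "v \<in> carrier N"
          "u \<sqsubseteq>\<^bsub>N\<^esub> g x" "v \<sqsubseteq>\<^bsub>N\<^esub> g y"
          unfolding Idl_map_iff[OF I] Idl_map_iff[OF J] by auto
        moreover have "g x \<in> carrier N" "g y \<in> carrier N"
          using uv I' J' mult_semilattice_morD(3)[OF g] by auto
        ultimately have "u \<cdot>\<^bsub>N\<^esub> v \<sqsubseteq>\<^bsub>N\<^esub> g (x \<cdot>\<^bsub>M\<^esub> y)" "u \<cdot>\<^bsub>N\<^esub> v \<in> carrier N"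
          by (simp_all add: gxy N.omult_mono N.omult_closed)
        with uv show "u \<cdot>\<^bsub>N\<^esub> v \<in> Idl_map M N g (I \<cdot>\<^bsub>Idl_magma M\<^esub> J)"
          unfolding Idl_map_iff[OF IJ] using Idl_omult_mem[OF M I J] by blast
      qed
    qed
  next
    fix \<X> assume "\<X> \<subseteq> carrier (Idl_magma M)" and ne: "\<X> \<noteq> {}"
    then have X: "\<X> \<subseteq> order_ideals M" by simp
    have Y: "Idl_map M N g ` \<X> \<subseteq> order_ideals N" "Idl_map M N g ` \<X> \<noteq> {}"
      using X ne by (auto intro!: Idl_map_ideal)
    note S = Idl_Sup_ideal[OF M X ne] and K = Idl_Sup_ideal[OF N Y]
    let ?K = "\<Squnion>\<^bsub>Idl_magma N\<^esub>(Idl_map M N g ` \<X>)"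
    \<comment> \<open>\<open>R\<close> is the preimage under \<open>g\<close> of the supremum
      \<open>?K\<close> of the image ideals. It is an ideal because \<open>g\<close> preserves joins
      and order, and it contains every member of the family, hence also the ideal generated by
      them.\<close>
    define R where "R = {x \<in> carrier M. g x \<in> ?K}"
    have sub: "I \<subseteq> R" if "I \<in> \<X>" for I
    proof
      fix x assume x: "x \<in> I"
      have I: "I \<in> order_ideals M" using that X by blast
      have "g x \<in> Idl_map M N g I" using Idl_map_mem[OF I x] .
      moreover have "Idl_map M N g I \<subseteq> ?K" using that by (intro Idl_Sup_upper[OF N Y(1)]) simp
      ultimately show "x \<in> R"
        using x order_idealsD(1)[OF M I] unfolding R_def by auto
    qed
    have "R \<in> order_ideals M"
      unfolding M.order_ideals_iff
    proof (intro conjI ballI impI)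
      obtain I where "I \<in> \<X>" using ne by blast
      then show "R \<noteq> {}" using sub[of I] X order_idealsD(2)[OF M, of I] by blast
      show "R \<subseteq> carrier M" unfolding R_def by auto
      show "a \<squnion>\<^bsub>M\<^esub> b \<in> R" if "a \<in> R" "b \<in> R" for a b
        using that order_idealsD(3)[OF N K] mult_semilattice_mor_join[OF g] unfolding R_def by simp
      show "b \<in> R" if "a \<in> R" "b \<in> carrier M" "b \<sqsubseteq>\<^bsub>M\<^esub> a" for a b
        using that order_idealsD(4)[OF N K, of "g a" "g b"] mult_semilattice_mor_mono[OF g, of b a]
          mult_semilattice_morD(3)[OF g] unfolding R_def by auto
    qed
    then have SR: "\<Squnion>\<^bsub>Idl_magma M\<^esub>\<X> \<subseteq> R"
      using sub by (rule Idl_Sup_least[OF M X ne])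
    show "Idl_map M N g (\<Squnion>\<^bsub>Idl_magma M\<^esub>\<X>) = ?K"
    proof
      show "Idl_map M N g (\<Squnion>\<^bsub>Idl_magma M\<^esub>\<X>) \<subseteq> ?K"
        using SR by (intro Idl_map_least[OF S K]) (auto simp: R_def)
      show "?K \<subseteq> Idl_map M N g (\<Squnion>\<^bsub>Idl_magma M\<^esub>\<X>)"
      proof (rule Idl_Sup_least[OF N Y Idl_map_ideal[OF S]])
        fix J assume "J \<in> Idl_map M N g ` \<X>"
        then obtain I where I: "I \<in> \<X>" "J = Idl_map M N g I" by blast
        then have "I \<in> order_ideals M" using X by blast
        then show "J \<subseteq> Idl_map M N g (\<Squnion>\<^bsub>Idl_magma M\<^esub>\<X>)"
          unfolding I(2) using Idl_Sup_upper[OF M X I(1)]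
          by (intro Idl_map_least Idl_map_ideal[OF S] Idl_map_mem[OF S]) auto
      qed
    qed
  qed
qed

end

text \<open>Naturality of I \<mapsto> \<Squnion>I. The image of \<open>I\<close> under
  \<open>f\<close> is cofinal in the ideal it generates, so the two have the same supremum in
  \<open>R\<close>, and \<open>f\<close> preserves suprema of nonempty sets.\<close>

lemma Sup_Idl_map_K_map:
  assumes f: "precoherent_mor Q R f" and I: "I \<in> order_ideals (K_magma Q)"
  shows "\<Squnion>\<^bsub>R\<^esub>(Idl_map (K_magma Q) (K_magma R) (K_map Q f) I) = f (\<Squnion>\<^bsub>Q\<^esub>I)"
proof -
  note Q = precoherent_morD(1)[OF f] and R = precoherent_morD(2)[OF f]
  note Kf = K_map_mor[OF f]
  interpret R: precoherent_near_prequantale R by (fact R)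
  note I' = K_ideal_directed[OF Q I] and J' = K_ideal_directed[OF R Idl_map_ideal[OF Kf I]]
  let ?J = "Idl_map (K_magma Q) (K_magma R) (K_map Q f) I"
  have Kf_eq: "K_map Q f x = f x" if "x \<in> I" for x
    using I'(2) that by (auto simp: K_map_def)
  have fI: "f ` I \<subseteq> carrier R" "f ` I \<noteq> {}"
    using I' precoherent_morD(3)[OF f] by auto
  have "\<Squnion>\<^bsub>R\<^esub>?J = \<Squnion>\<^bsub>R\<^esub>(f ` I)"
  proof (rule R.le_antisym)
    note cl = R.Sup_closed[OF J'(3,4)] R.Sup_closed[OF fI]
    then show "\<Squnion>\<^bsub>R\<^esub>?J \<in> carrier R" "\<Squnion>\<^bsub>R\<^esub>(f ` I) \<in> carrier R" by simp_all
    show "\<Squnion>\<^bsub>R\<^esub>(f ` I) \<sqsubseteq>\<^bsub>R\<^esub> \<Squnion>\<^bsub>R\<^esub>?J"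
      using Idl_map_mem[OF Kf I] Kf_eq by (intro R.Sup_least[OF fI cl(1)] R.Sup_upper[OF J'(3)]) force
    show "\<Squnion>\<^bsub>R\<^esub>?J \<sqsubseteq>\<^bsub>R\<^esub> \<Squnion>\<^bsub>R\<^esub>(f ` I)"
    proof (rule R.Sup_least[OF J'(3,4) cl(2)])
      fix z assume z: "z \<in> ?J"
      then obtain x where x: "x \<in> I" "z \<sqsubseteq>\<^bsub>R\<^esub> f x"
        using Kf_eq unfolding Idl_map_iff[OF Kf I] by auto
      have "f x \<sqsubseteq>\<^bsub>R\<^esub> \<Squnion>\<^bsub>R\<^esub>(f ` I)" using x by (intro R.Sup_upper[OF fI(1)]) simp
      then show "z \<sqsubseteq>\<^bsub>R\<^esub> \<Squnion>\<^bsub>R\<^esub>(f ` I)"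
        using R.le_trans[OF x(2)] cl fI z J'(3) x(1) by blast
    qed
  qed
  then show ?thesis
    using precoherent_morD(6)[OF f I'(3,4)] by simp
qed

section \<open>Identities and composites\<close>

lemma K_map_id: "K_map Q (\<lambda>x\<in>carrier Q. x) = (\<lambda>x\<in>carrier (K_magma Q). x)"
  using compacts_carrier[of Q] by (auto simp: K_map_def restrict_def fun_eq_iff)

text \<open>Because \<open>f\<close> carries compact elements to compact elements, the restricted
  \<open>g\<close> is evaluated only where it agrees with \<open>g\<close>.\<close>

lemma K_map_compose:
  assumes "precoherent_mor Q R f"
  shows "K_map Q (compose (carrier Q) g f) = compose (carrier (K_magma Q)) (K_map R g) (K_map Q f)"
  using compacts_carrier[of Q] precoherent_morD(4)[OF assms]
  by (auto simp: K_map_def compose_def fun_eq_iff)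

lemma Idl_map_id:
  assumes M: "multiplicative_semilattice M"
  shows "Idl_map M M (\<lambda>x\<in>carrier M. x) = (\<lambda>I\<in>carrier (Idl_magma M). I)"
proof
  fix I
  interpret multiplicative_semilattice M by (fact M)
  show "Idl_map M M (\<lambda>x\<in>carrier M. x) I = (\<lambda>I\<in>carrier (Idl_magma M). I) I"
  proof (cases "I \<in> order_ideals M")
    case True
    then have "I \<subseteq> carrier M" by (rule order_idealsD(1)[OF M])
    then have "(\<lambda>x\<in>carrier M. x) ` I = I" by force
    with True \<open>I \<subseteq> carrier M\<close> show ?thesis
      using down_set_least[OF True subset_refl] down_set_superset[of I] by (auto simp: Idl_map_def)
  qed (simp add: Idl_map_def)
qed

text \<open>On an ideal \<open>I\<close> both sides consist of the elements below some
  \<open>h (g x)\<close> with \<open>x \<in> I\<close>: monotonicity of \<open>h\<close> absorbs the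
  downward closure taken in \<open>N\<close>. On sets that are not ideals both sides are
  \<open>undefined\<close>.\<close>

lemma Idl_map_compose:
  assumes g: "mult_semilattice_mor M N g" and h: "mult_semilattice_mor N P h"
  shows "Idl_map M P (compose (carrier M) h g) =
    compose (carrier (Idl_magma M)) (Idl_map N P h) (Idl_map M N g)"
proof
  fix I
  note hg = mult_semilattice_mor_compose[OF g h]
  show "Idl_map M P (compose (carrier M) h g) I =
    compose (carrier (Idl_magma M)) (Idl_map N P h) (Idl_map M N g) I"
  proof (cases "I \<in> order_ideals M")
    case True
    note IM = order_idealsD(1)[OF mult_semilattice_morD(1)[OF g] True]
    note gI = Idl_map_ideal[OF g True]
    note P = mult_semilattice_morD(2)[OF h]
    interpret P: multiplicative_semilattice P by (fact P)
    have c: "compose (carrier M) h g x = h (g x)" if "x \<in> I" for x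
      using IM that by (auto simp: compose_def)
    have "Idl_map M P (compose (carrier M) h g) I = Idl_map N P h (Idl_map M N g I)"
    proof
      show "Idl_map M P (compose (carrier M) h g) I \<subseteq> Idl_map N P h (Idl_map M N g I)"
        by (rule Idl_map_least[OF hg True Idl_map_ideal[OF h gI]])
          (simp add: c Idl_map_mem[OF h gI] Idl_map_mem[OF g True])
      show "Idl_map N P h (Idl_map M N g I) \<subseteq> Idl_map M P (compose (carrier M) h g) I"
      proof (rule Idl_map_least[OF h gI Idl_map_ideal[OF hg True]])
        fix y assume "y \<in> Idl_map M N g I"
        then obtain x where x: "y \<in> carrier N" "x \<in> I" "y \<sqsubseteq>\<^bsub>N\<^esub> g x"
          unfolding Idl_map_iff[OF g True] by blast
        moreover have "g x \<in> carrier N" using x IM mult_semilattice_morD(3)[OF g] by blast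
        ultimately have "h y \<sqsubseteq>\<^bsub>P\<^esub> h (g x)" "h y \<in> carrier P"
          using mult_semilattice_mor_mono[OF h, of y "g x"] mult_semilattice_morD(3)[OF h] by auto
        with x show "h y \<in> Idl_map M P (compose (carrier M) h g) I"
          unfolding Idl_map_iff[OF hg True] using c by auto
      qed
    qed
    with True show ?thesis by (simp add: compose_def)
  qed (simp add: compose_def Idl_map_def)
qed

lemma precoherent_mor_compose:
  assumes f: "precoherent_mor Q R f" and g: "precoherent_mor R S g"
  shows "precoherent_mor Q S (compose (carrier Q) g f)"
proof -
  note f' = precoherent_morD[OF f] and g' = precoherent_morD[OF g]
  interpret Q: precoherent_near_prequantale Q by (fact f'(1))
  show ?thesis
  proof (rule precoherent_morI[OF f'(1) g'(2)])
    show "compose (carrier Q) g f \<in> carrier Q \<rightarrow> carrier S"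
      using f'(3) g'(3) by (auto simp: compose_def)
    show "compose (carrier Q) g f \<in> compacts Q \<rightarrow> compacts S"
      using funcset_mem[OF g'(4) funcset_mem[OF f'(4)]] compacts_carrier[of Q]
      by (simp add: compose_def subset_iff)
    fix x y assume xy: "x \<in> carrier Q" "y \<in> carrier Q"
    then have "f x \<in> carrier R" "f y \<in> carrier R" using f'(3) by auto
    with xy show "compose (carrier Q) g f (x \<cdot>\<^bsub>Q\<^esub> y) =
        compose (carrier Q) g f x \<cdot>\<^bsub>S\<^esub> compose (carrier Q) g f y"
      by (simp add: compose_def Q.omult_closed f'(5) g'(5))
  next
    fix X assume X: "X \<subseteq> carrier Q" "X \<noteq> {}"
    then have "f ` X \<subseteq> carrier R" "f ` X \<noteq> {}" using f'(3) by auto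
    moreover have "compose (carrier Q) g f ` X = g ` f ` X"
      unfolding image_image using X by (intro image_cong) (auto simp: compose_def)
    ultimately show "compose (carrier Q) g f (\<Squnion>\<^bsub>Q\<^esub>X) = \<Squnion>\<^bsub>S\<^esub>(compose (carrier Q) g f ` X)"
      using X by (simp add: compose_def Q.Sup_closed f'(6) g'(6))
  qed
qed

section \<open>Isomorphisms and transport of structure\<close>

text \<open>Directed sets and their least upper bounds lie in the carrier anyway; with the bounds
  made explicit, the quantifiers can be moved along a bijection of carriers.\<close>

lemma compacts_iff:
  "x \<in> compacts S \<longleftrightarrow> x \<in> carrier S \<and> (\<forall>D\<subseteq>carrier S. \<forall>s\<in>carrier S.
    directed_subset S D \<and> is_lub S s D \<and> x \<sqsubseteq>\<^bsub>S\<^esub> s \<longrightarrow> (\<exists>y\<in>D. x \<sqsubseteq>\<^bsub>S\<^esub> y))"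
proof -
  have "D \<subseteq> carrier S" if "directed_subset S D" for D
    using that unfolding directed_subset_def by simp
  then show ?thesis
    unfolding compacts_def mem_Collect_eq by (meson least_closed)
qed

context
  fixes A :: "'a omagma" and B :: "'b omagma" and f
  assumes iso: "omagma_iso A B f"
begin

interpretation A: ordered_magma A using iso unfolding omagma_iso_def by blast
interpretation B: ordered_magma B using iso unfolding omagma_iso_def by blast

lemma omagma_iso_simps:
  "x \<in> carrier A \<Longrightarrow> f x \<in> carrier B"
  "\<lbrakk>x \<in> carrier A; y \<in> carrier A\<rbrakk> \<Longrightarrow> f x \<sqsubseteq>\<^bsub>B\<^esub> f y \<longleftrightarrow> x \<sqsubseteq>\<^bsub>A\<^esub> y"
  "\<lbrakk>x \<in> carrier A; y \<in> carrier A\<rbrakk> \<Longrightarrow> f (x \<cdot>\<^bsub>A\<^esub> y) = f x \<cdot>\<^bsub>B\<^esub> f y"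
  "inj_on f (carrier A)"
  "f ` carrier A = carrier B"
  using iso unfolding omagma_iso_def magma_hom_def order_emb_def bij_betw_def by auto

text \<open>By surjectivity every candidate upper bound in \<open>B\<close> has the form
  \<open>f y\<close>, and the order embedding then removes \<open>f\<close> from each
  inequality.\<close>

lemma omagma_iso_is_lub:
  assumes "X \<subseteq> carrier A" "s \<in> carrier A"
  shows "is_lub B (f s) (f ` X) \<longleftrightarrow> is_lub A s X"
proof -
  have fX: "f ` X \<subseteq> carrier B" using assms omagma_iso_simps(1) by blast
  have "(\<forall>y\<in>carrier B. (\<forall>x\<in>X. f x \<sqsubseteq>\<^bsub>B\<^esub> y) \<longrightarrow> f s \<sqsubseteq>\<^bsub>B\<^esub> y) \<longleftrightarrow>
      (\<forall>y\<in>carrier A. (\<forall>x\<in>X. f x \<sqsubseteq>\<^bsub>B\<^esub> f y) \<longrightarrow> f s \<sqsubseteq>\<^bsub>B\<^esub> f y)"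
    unfolding omagma_iso_simps(5)[symmetric] by simp
  also have "\<dots> \<longleftrightarrow> (\<forall>y\<in>carrier A. (\<forall>x\<in>X. x \<sqsubseteq>\<^bsub>A\<^esub> y) \<longrightarrow> s \<sqsubseteq>\<^bsub>A\<^esub> y)"
    using assms by (simp add: omagma_iso_simps(2) subset_iff)
  finally show ?thesis
    unfolding is_lub_iff[OF fX] is_lub_iff[OF assms(1)]
    using assms by (simp add: omagma_iso_simps(1,2) subset_iff)
qed

lemma omagma_iso_Sup:
  assumes "X \<subseteq> carrier A" "is_lub A s X"
  shows "\<Squnion>\<^bsub>B\<^esub>(f ` X) = f s"
  using assms omagma_iso_is_lub[OF assms(1) least_closed[OF assms(2)]] by (intro B.sup_eqI) simp

lemma omagma_iso_directed:
  assumes "D \<subseteq> carrier A"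
  shows "directed_subset B (f ` D) \<longleftrightarrow> directed_subset A D"
proof -
  have "(\<exists>z\<in>D. f x \<sqsubseteq>\<^bsub>B\<^esub> f z \<and> f y \<sqsubseteq>\<^bsub>B\<^esub> f z) \<longleftrightarrow> (\<exists>z\<in>D. x \<sqsubseteq>\<^bsub>A\<^esub> z \<and> y \<sqsubseteq>\<^bsub>A\<^esub> z)"
    if "x \<in> D" "y \<in> D" for x y
    using that assms by (intro bex_cong) (simp_all add: omagma_iso_simps(2) subset_iff)
  then show ?thesis
    unfolding A.directed_subset_iff B.directed_subset_iff
    using assms omagma_iso_simps(1) by (simp add: subset_iff image_iff) blast
qed

lemma omagma_iso_compacts: "compacts B = f ` compacts A"
proof -
  have *: "f x \<in> compacts B \<longleftrightarrow> x \<in> compacts A" if x: "x \<in> carrier A" for x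
  proof -
    have "f x \<in> compacts B \<longleftrightarrow> (\<forall>D\<subseteq>carrier B. \<forall>s\<in>carrier B.
        directed_subset B D \<and> is_lub B s D \<and> f x \<sqsubseteq>\<^bsub>B\<^esub> s \<longrightarrow> (\<exists>y\<in>D. f x \<sqsubseteq>\<^bsub>B\<^esub> y))"
      using x by (simp add: compacts_iff omagma_iso_simps(1))
    \<comment> \<open>Surjectivity turns subsets and elements of \<open>carrier B\<close> into
      images of subsets and elements of \<open>carrier A\<close>.\<close>
    also have "\<dots> \<longleftrightarrow> (\<forall>D\<subseteq>carrier A. \<forall>s\<in>carrier A.
        directed_subset B (f ` D) \<and> is_lub B (f s) (f ` D) \<and> f x \<sqsubseteq>\<^bsub>B\<^esub> f s \<longrightarrow> (\<exists>y\<in>f ` D. f x \<sqsubseteq>\<^bsub>B\<^esub> y))"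
      unfolding omagma_iso_simps(5)[symmetric] all_subset_image by simp
    also have "\<dots> \<longleftrightarrow> (\<forall>D\<subseteq>carrier A. \<forall>s\<in>carrier A.
        directed_subset A D \<and> is_lub A s D \<and> x \<sqsubseteq>\<^bsub>A\<^esub> s \<longrightarrow> (\<exists>y\<in>D. x \<sqsubseteq>\<^bsub>A\<^esub> y))"
    proof (intro all_cong ball_cong refl)
      fix D s assume D: "D \<subseteq> carrier A" and s: "s \<in> carrier A"
      have "(\<exists>y\<in>f ` D. f x \<sqsubseteq>\<^bsub>B\<^esub> y) \<longleftrightarrow> (\<exists>y\<in>D. x \<sqsubseteq>\<^bsub>A\<^esub> y)"
        using D x by (simp add: omagma_iso_simps(2) subset_iff cong: bex_cong)
      then show "(directed_subset B (f ` D) \<and> is_lub B (f s) (f ` D) \<and> f x \<sqsubseteq>\<^bsub>B\<^esub> f s \<longrightarrow> (\<exists>y\<in>f ` D. f x \<sqsubseteq>\<^bsub>B\<^esub> y))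
          = (directed_subset A D \<and> is_lub A s D \<and> x \<sqsubseteq>\<^bsub>A\<^esub> s \<longrightarrow> (\<exists>y\<in>D. x \<sqsubseteq>\<^bsub>A\<^esub> y))"
        using D x s by (simp add: omagma_iso_directed omagma_iso_is_lub omagma_iso_simps(2))
    qed
    also have "\<dots> \<longleftrightarrow> x \<in> compacts A"
      using x by (simp add: compacts_iff)
    finally show ?thesis .
  qed
  then show ?thesis
  proof (intro equalityI subsetI)
    fix y assume y: "y \<in> compacts B"
    then have "y \<in> f ` carrier A"
      using omagma_iso_simps(5) subsetD[OF compacts_carrier] by simp
    with y * show "y \<in> f ` compacts A" by auto
  next
    fix y assume "y \<in> f ` compacts A"
    then obtain x where "y = f x" "x \<in> compacts A" by blast
    with * show "y \<in> compacts B" using subsetD[OF compacts_carrier] by metis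
  qed
qed

lemma omagma_iso_near_prequantale:
  assumes "near_prequantale A"
  shows "near_prequantale B"
proof -
  interpret A: near_prequantale A by (fact assms)
  have Sup: "\<Squnion>\<^bsub>B\<^esub>(f ` X) = f (\<Squnion>\<^bsub>A\<^esub>X)" if "X \<subseteq> carrier A" "X \<noteq> {}" for X
    using that by (intro omagma_iso_Sup A.Sup_is_lub)
  show ?thesis
  proof unfold_locales
    fix Y assume "Y \<subseteq> carrier B" "Y \<noteq> {}"
    then obtain X where X: "Y = f ` X" "X \<subseteq> carrier A" "X \<noteq> {}"
      unfolding omagma_iso_simps(5)[symmetric] subset_image_iff by blast
    then show "\<exists>s. is_lub B s Y"
      using A.Sup_is_lub[of X] omagma_iso_is_lub[of X "\<Squnion>\<^bsub>A\<^esub>X"] A.Sup_closed[of X] by blast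
  next
    fix b Y assume "b \<in> carrier B" "Y \<subseteq> carrier B" "Y \<noteq> {}"
    then obtain a X where X: "Y = f ` X" "X \<subseteq> carrier A" "X \<noteq> {}" and a: "b = f a" "a \<in> carrier A"
      unfolding omagma_iso_simps(5)[symmetric] subset_image_iff by blast
    have "(\<lambda>y. b \<cdot>\<^bsub>B\<^esub> y) ` Y = f ` (\<lambda>x. a \<cdot>\<^bsub>A\<^esub> x) ` X" "(\<lambda>y. y \<cdot>\<^bsub>B\<^esub> b) ` Y = f ` (\<lambda>x. x \<cdot>\<^bsub>A\<^esub> a) ` X"
      unfolding X a image_image using X a by (auto simp: omagma_iso_simps(3) subset_iff intro!: image_cong)
    moreover have "(\<lambda>x. a \<cdot>\<^bsub>A\<^esub> x) ` X \<subseteq> carrier A" "(\<lambda>x. x \<cdot>\<^bsub>A\<^esub> a) ` X \<subseteq> carrier A"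
      using X a by (auto intro!: A.omult_closed)
    ultimately show "b \<cdot>\<^bsub>B\<^esub> \<Squnion>\<^bsub>B\<^esub>Y = \<Squnion>\<^bsub>B\<^esub>((\<lambda>y. b \<cdot>\<^bsub>B\<^esub> y) ` Y)"
      and "\<Squnion>\<^bsub>B\<^esub>Y \<cdot>\<^bsub>B\<^esub> b = \<Squnion>\<^bsub>B\<^esub>((\<lambda>y. y \<cdot>\<^bsub>B\<^esub> b) ` Y)"
      using X a A.omult_Sup_left[OF a(2) X(2,3)] A.omult_Sup_right[OF a(2) X(2,3)]
        A.Sup_closed[OF X(2,3)] by (simp_all add: Sup omagma_iso_simps(3)[symmetric])
  qed
qed

lemma omagma_iso_precoherent:
  assumes "precoherent A"
  shows "precoherent B"
proof -
  interpret A: precoherent A by (fact assms)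
  show ?thesis
  proof unfold_locales
    fix b assume "b \<in> carrier B"
    then obtain a where a: "b = f a" "a \<in> carrier A" using omagma_iso_simps(5) by blast
    with A.compactly_generated obtain X where X: "X \<subseteq> compacts A" "is_lub A a X" by blast
    moreover from this have "X \<subseteq> carrier A" using compacts_carrier[of A] by blast
    ultimately have "f ` X \<subseteq> compacts B \<and> is_lub B b (f ` X)"
      using a omagma_iso_is_lub[of X a] omagma_iso_compacts by blast
    then show "\<exists>Y. Y \<subseteq> compacts B \<and> is_lub B b Y" ..
  next
    fix x y assume "x \<in> compacts B" "y \<in> compacts B"
    then obtain a b where ab: "x = f a" "y = f b" "a \<in> compacts A" "b \<in> compacts A"
      using omagma_iso_compacts by blast
    moreover from this have "a \<in> carrier A" "b \<in> carrier A" using compacts_carrier[of A] by blast+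
    ultimately show "x \<cdot>\<^bsub>B\<^esub> y \<in> compacts B"
      unfolding omagma_iso_compacts
      using A.compacts_closed[of a b] by (simp add: omagma_iso_simps(3)[symmetric])
  qed
qed

lemma omagma_iso_precoherent_near_prequantale:
  "precoherent_near_prequantale A \<Longrightarrow> precoherent_near_prequantale B"
  unfolding precoherent_near_prequantale_def
  using omagma_iso_near_prequantale omagma_iso_precoherent by blast

text \<open>An order isomorphism preserves all existing suprema and compactness, so an isomorphism
  of ordered magmas is automatically a morphism. Applied to its inverse as well, this makes it
  invertible in the category.\<close>

lemma omagma_iso_precoherent_mor:
  assumes A: "precoherent_near_prequantale A"
  shows "precoherent_mor A B f"
proof -
  interpret A: precoherent_near_prequantale A by (fact A)
  show ?thesis
    by (rule precoherent_morI[OF A omagma_iso_precoherent_near_prequantale[OF A]])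
      (auto simp: omagma_iso_simps(1,3) omagma_iso_compacts omagma_iso_Sup[OF _ A.Sup_is_lub])
qed

lemma omagma_iso_mult_semilattice_mor:
  assumes A: "multiplicative_semilattice A" and B: "multiplicative_semilattice B"
  shows "mult_semilattice_mor A B f"
proof -
  interpret A: multiplicative_semilattice A by (fact A)
  show ?thesis
    by (rule mult_semilattice_morI[OF A B])
      (auto simp: omagma_iso_simps(1,3) omagma_iso_Sup[OF _ A.finite_sup_least])
qed

lemma omagma_iso_inv: "omagma_iso B A (inv_into (carrier A) f)"
proof -
  let ?g = "inv_into (carrier A) f"
  have g: "?g y \<in> carrier A" "f (?g y) = y" if "y \<in> carrier B" for y
    using that by (simp_all add: inv_into_into f_inv_into_f omagma_iso_simps(5))
  have "?g (x \<cdot>\<^bsub>B\<^esub> y) = ?g x \<cdot>\<^bsub>A\<^esub> ?g y" if "x \<in> carrier B" "y \<in> carrier B" for x y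
    using that g by (intro inv_into_f_eq) (simp_all add: omagma_iso_simps(3,4) A.omult_closed)
  moreover have "?g x \<sqsubseteq>\<^bsub>A\<^esub> ?g y \<longleftrightarrow> x \<sqsubseteq>\<^bsub>B\<^esub> y" if "x \<in> carrier B" "y \<in> carrier B" for x y
    using that g omagma_iso_simps(2)[of "?g x" "?g y"] by simp
  moreover have "bij_betw ?g (carrier B) (carrier A)"
    using iso by (simp add: omagma_iso_def bij_betw_inv_into)
  ultimately show ?thesis
    unfolding omagma_iso_def magma_hom_def order_emb_def
    using g A.ordered_magma_axioms B.ordered_magma_axioms A.weak_partial_order_axioms
      B.weak_partial_order_axioms by auto
qed

text \<open>It exchanges the inverse of I \<mapsto> \<Squnion>I obtained by choice for the explicit
  map \<open>compacts_below Q\<close>.\<close>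

lemma omagma_iso_cong:
  assumes "\<And>x. x \<in> carrier A \<Longrightarrow> f x = g x"
  shows "omagma_iso A B g"
proof -
  have "bij_betw g (carrier A) (carrier B)"
    using iso assms bij_betw_cong[of "carrier A" f g] unfolding omagma_iso_def by simp
  moreover have "g \<in> carrier A \<rightarrow> carrier B"
    using omagma_iso_simps(1) assms by fastforce
  ultimately show ?thesis
    using iso assms by (simp add: omagma_iso_def magma_hom_def order_emb_def A.omult_closed)
qed

lemma K_omagma_iso:
  assumes "multiplicative_semilattice (K_magma A)" "multiplicative_semilattice (K_magma B)"
  shows "omagma_iso (K_magma A) (K_magma B) f"
proof -
  interpret KA: multiplicative_semilattice "K_magma A" by (fact assms(1))
  interpret KB: multiplicative_semilattice "K_magma B" by (fact assms(2))
  have K: "x \<in> carrier A" if "x \<in> compacts A" for x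
    using that compacts_carrier[of A] by blast
  have "inj_on f (compacts A)"
    using omagma_iso_simps(4) compacts_carrier[of A] by (rule inj_on_subset)
  then show ?thesis
    unfolding omagma_iso_def magma_hom_def order_emb_def bij_betw_def
    using KA.ordered_magma_axioms KB.ordered_magma_axioms KA.weak_partial_order_axioms
      KB.weak_partial_order_axioms by (simp add: omagma_iso_compacts omagma_iso_simps(2,3) K)
qed

end

lemma omagma_iso_comp:
  fixes A :: "'a omagma" and B :: "'b omagma" and C :: "'c omagma"
  assumes f: "omagma_iso A B f" and g: "omagma_iso B C g"
  shows "omagma_iso A C (g \<circ> f)"
proof -
  have "bij_betw (g \<circ> f) (carrier A) (carrier C)"
    using f g by (auto simp: omagma_iso_def intro: bij_betw_trans)
  then show ?thesis
    using f g omagma_iso_simps(1-3)[OF f] omagma_iso_simps(1-3)[OF g]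
    by (simp add: omagma_iso_def magma_hom_def order_emb_def)
qed

lemma omagma_iso_id:
  fixes A :: "'a omagma"
  shows "ordered_magma A \<Longrightarrow> omagma_iso A A (\<lambda>x. x)"
  by (auto simp: omagma_iso_def magma_hom_def order_emb_def ordered_magma_def partial_order_def
      bij_betw_def inj_on_def)

text \<open>\<open>transport\<close> decodes its arguments with \<open>inv_into\<close>, which
  undoes \<open>c\<close> by injectivity. Order and product are from here on computed by writing
  every element in the form \<open>c x\<close>.\<close>

lemma transport_simps:
  assumes c: "inj_on c (carrier M)"
  shows "carrier (transport c M) = c ` carrier M" "eq (transport c M) = (=)"
    "\<lbrakk>x \<in> carrier M; y \<in> carrier M\<rbrakk> \<Longrightarrow> c x \<sqsubseteq>\<^bsub>transport c M\<^esub> c y \<longleftrightarrow> x \<sqsubseteq>\<^bsub>M\<^esub> y"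
    "\<lbrakk>x \<in> carrier M; y \<in> carrier M\<rbrakk> \<Longrightarrow> c x \<cdot>\<^bsub>transport c M\<^esub> c y = c (x \<cdot>\<^bsub>M\<^esub> y)"
  using c by (simp_all add: transport_def Let_def)

lemma transport_iso:
  assumes M: "ordered_magma M" and c: "inj_on c (carrier M)"
  shows "omagma_iso M (transport c M) c"
proof -
  interpret ordered_magma M by (fact M)
  note t = transport_simps[OF c]
  interpret T: ordered_magma "transport c M"
  proof unfold_locales
    fix x y z
    assume "x \<sqsubseteq>\<^bsub>transport c M\<^esub> y" "y \<sqsubseteq>\<^bsub>transport c M\<^esub> z"
      "x \<in> carrier (transport c M)" "y \<in> carrier (transport c M)" "z \<in> carrier (transport c M)"
    then show "x \<sqsubseteq>\<^bsub>transport c M\<^esub> z"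
      unfolding t(1) by (elim imageE) (simp add: t(3), metis le_trans)
  next
    fix x x' y y'
    assume "x \<in> carrier (transport c M)" "x' \<in> carrier (transport c M)"
      "y \<in> carrier (transport c M)" "y' \<in> carrier (transport c M)"
      "x \<sqsubseteq>\<^bsub>transport c M\<^esub> x'" "y \<sqsubseteq>\<^bsub>transport c M\<^esub> y'"
    then show "x \<cdot>\<^bsub>transport c M\<^esub> y \<sqsubseteq>\<^bsub>transport c M\<^esub> x' \<cdot>\<^bsub>transport c M\<^esub> y'"
      unfolding t(1) by (elim imageE) (simp add: t(3,4) omult_closed omult_mono)
  next
    fix x y
    assume "x \<in> carrier (transport c M)" "y \<in> carrier (transport c M)"
    then show "x \<cdot>\<^bsub>transport c M\<^esub> y \<in> carrier (transport c M)"
      unfolding t(1) by (elim imageE) (simp add: t(4) omult_closed)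
  next
    fix x y
    assume "x \<sqsubseteq>\<^bsub>transport c M\<^esub> y" "y \<sqsubseteq>\<^bsub>transport c M\<^esub> x"
      "x \<in> carrier (transport c M)" "y \<in> carrier (transport c M)"
    then show "x .=\<^bsub>transport c M\<^esub> y"
      unfolding t(1,2) by (elim imageE) (simp add: t(3), metis le_antisym)
  next
    fix x assume "x \<in> carrier (transport c M)"
    then show "x \<sqsubseteq>\<^bsub>transport c M\<^esub> x"
      unfolding t(1) by (elim imageE) (simp add: t(3))
  qed (simp_all add: t(2))
  show ?thesis
    unfolding omagma_iso_def magma_hom_def order_emb_def bij_betw_def
    using M T.ordered_magma_axioms weak_partial_order_axioms T.weak_partial_order_axioms c
    by (simp add: t)
qed

section \<open>The equivalence of categories\<close>

lemma cat_functor_id: "category C \<Longrightarrow> cat_functor C C id_ftor"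
  by (simp add: cat_functor_def cat_functor_axioms_def id_ftor_def)

lemma cat_functor_comp:
  assumes "cat_functor C D F" "cat_functor D E G"
  shows "cat_functor C E (comp_ftor G F)"
proof -
  interpret F: cat_functor C D F by (fact assms(1))
  interpret G: cat_functor D E G by (fact assms(2))
  show ?thesis
    by unfold_locales
      (simp_all add: comp_ftor_def F.on_obj_Obj G.on_obj_Obj F.on_arr_Hom G.on_arr_Hom
        F.on_arr_Id G.on_arr_Id F.on_arr_Comp G.on_arr_Comp)
qed

text \<open>Arrows are extensional, so maps have to be cut down to the carrier. The restriction is
  the composite with the identity of \<open>R\<close>, a morphism because it is an isomorphism, and
  closure under composition applies.\<close>

lemma precoherent_mor_restrict:
  fixes Q :: "'a omagma" and R :: "'b omagma"
  assumes f: "precoherent_mor Q R f"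
  shows "precoherent_mor Q R (restrict f (carrier Q))"
proof -
  note f' = precoherent_morD[OF f]
  interpret R: precoherent_near_prequantale R by (fact f'(2))
  have "compose (carrier Q) (\<lambda>x. x) f = restrict f (carrier Q)"
    by (auto simp: compose_def)
  moreover have "precoherent_mor R R (\<lambda>x. x)"
    by (intro omagma_iso_precoherent_mor omagma_iso_id R.ordered_magma_axioms f'(2))
  ultimately show ?thesis
    using precoherent_mor_compose[OF f] by metis
qed

lemma mult_semilattice_mor_restrict:
  fixes M :: "'a omagma" and N :: "'b omagma"
  assumes g: "mult_semilattice_mor M N g"
  shows "mult_semilattice_mor M N (restrict g (carrier M))"
proof -
  note g' = mult_semilattice_morD[OF g]
  interpret N: multiplicative_semilattice N by (fact g'(2))
  have "compose (carrier M) (\<lambda>x. x) g = restrict g (carrier M)"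
    by (auto simp: compose_def)
  moreover have "mult_semilattice_mor N N (\<lambda>x. x)"
    by (intro omagma_iso_mult_semilattice_mor omagma_iso_id N.ordered_magma_axioms g'(2))
  ultimately show ?thesis
    using mult_semilattice_mor_compose[OF g] by metis
qed

section \<open>The two categories, their isomorphisms and the functor \<open>K\<close>\<close>

lemma PNP_simps [simp]:
  "Q \<in> Obj (PNP_cat small) \<longleftrightarrow> precoherent_near_prequantale Q \<and> small (compacts Q)"
  "f \<in> Hom (PNP_cat small) Q R \<longleftrightarrow> f \<in> extensional (carrier Q) \<and> precoherent_mor Q R f"
  "Id (PNP_cat small) Q = (\<lambda>x\<in>carrier Q. x)"
  "Comp (PNP_cat small) Q R S g f = compose (carrier Q) g f"
  by (simp_all add: PNP_cat_def)

lemma MS_simps [simp]: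
  "M \<in> Obj (MS_cat small) \<longleftrightarrow> multiplicative_semilattice M \<and> small (carrier M)"
  "g \<in> Hom (MS_cat small) M N \<longleftrightarrow> g \<in> extensional (carrier M) \<and> mult_semilattice_mor M N g"
  "Id (MS_cat small) M = (\<lambda>x\<in>carrier M. x)"
  "Comp (MS_cat small) M N P g f = compose (carrier M) g f"
  by (simp_all add: MS_cat_def)

lemma PNP_category: "category (PNP_cat small)"
proof
  fix Q :: "'a omagma" assume "Q \<in> Obj (PNP_cat small)"
  then have Q: "precoherent_near_prequantale Q" by simp
  then interpret Q: precoherent_near_prequantale Q .
  show "Id (PNP_cat small) Q \<in> Hom (PNP_cat small) Q Q"
    using precoherent_mor_restrict[OF omagma_iso_precoherent_mor[OF omagma_iso_id[OF Q.ordered_magma_axioms] Q]]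
    by simp
next
  fix Q R S T :: "'a omagma" and f g h
  show "Comp (PNP_cat small) Q R S g f \<in> Hom (PNP_cat small) Q S"
    if "f \<in> Hom (PNP_cat small) Q R" "g \<in> Hom (PNP_cat small) R S"
    using that by (auto intro: precoherent_mor_compose)
  show "Comp (PNP_cat small) Q R R (Id (PNP_cat small) R) f = f"
    and "Comp (PNP_cat small) Q Q R f (Id (PNP_cat small) Q) = f"
    if "f \<in> Hom (PNP_cat small) Q R"
    using that precoherent_morD(3)[of Q R f] by (simp_all add: Id_compose compose_Id)
  show "Comp (PNP_cat small) Q R T (Comp (PNP_cat small) R S T h g) f =
      Comp (PNP_cat small) Q S T h (Comp (PNP_cat small) Q R S g f)"
    if "f \<in> Hom (PNP_cat small) Q R"
    using that precoherent_morD(3)[of Q R f] by (simp add: compose_assoc)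
qed

lemma MS_category: "category (MS_cat small)"
proof
  fix M :: "'a omagma" assume "M \<in> Obj (MS_cat small)"
  then have M: "multiplicative_semilattice M" by simp
  then interpret M: multiplicative_semilattice M .
  show "Id (MS_cat small) M \<in> Hom (MS_cat small) M M"
    using mult_semilattice_mor_restrict[OF
        omagma_iso_mult_semilattice_mor[OF omagma_iso_id[OF M.ordered_magma_axioms] M M]]
    by simp
next
  fix M N P S :: "'a omagma" and f g h
  show "Comp (MS_cat small) M N P g f \<in> Hom (MS_cat small) M P"
    if "f \<in> Hom (MS_cat small) M N" "g \<in> Hom (MS_cat small) N P"
    using that by (auto intro: mult_semilattice_mor_compose)
  show "Comp (MS_cat small) M N N (Id (MS_cat small) N) f = f"
    and "Comp (MS_cat small) M M N f (Id (MS_cat small) M) = f"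
    if "f \<in> Hom (MS_cat small) M N"
    using that mult_semilattice_morD(3)[of M N f] by (simp_all add: Id_compose compose_Id)
  show "Comp (MS_cat small) M N S (Comp (MS_cat small) N P S h g) f =
      Comp (MS_cat small) M P S h (Comp (MS_cat small) M N P g f)"
    if "f \<in> Hom (MS_cat small) M N"
    using that mult_semilattice_morD(3)[of M N f] by (simp add: compose_assoc)
qed

lemma omagma_iso_compose_inv:
  fixes A :: "'a omagma" and B :: "'b omagma"
  assumes f: "omagma_iso A B f"
  shows "compose (carrier A) (restrict (inv_into (carrier A) f) (carrier B)) (restrict f (carrier A))
      = (\<lambda>x\<in>carrier A. x)"
    and "compose (carrier B) (restrict f (carrier A)) (restrict (inv_into (carrier A) f) (carrier B))
      = (\<lambda>x\<in>carrier B. x)"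
  using omagma_iso_simps(1,4,5)[OF f]
  by (auto simp: compose_def restrict_def fun_eq_iff f_inv_into_f inv_into_into)

text \<open>The inverse arrow is the inverse function restricted to \<open>carrier R\<close>; it is
  a morphism since inverses of isomorphisms of ordered magmas are again such isomorphisms.\<close>

lemma PNP_iso_arrow:
  assumes f: "omagma_iso Q R f" and "Q \<in> Obj (PNP_cat small)" "R \<in> Obj (PNP_cat small)"
  shows "iso_arrow (PNP_cat small) Q R (restrict f (carrier Q))"
proof -
  have "precoherent_mor Q R (restrict f (carrier Q))"
    using assms by (intro precoherent_mor_restrict omagma_iso_precoherent_mor) simp_all
  moreover have "precoherent_mor R Q (restrict (inv_into (carrier Q) f) (carrier R))"
    using assms by (intro precoherent_mor_restrict omagma_iso_precoherent_mor omagma_iso_inv) simp_all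
  ultimately show ?thesis
    unfolding iso_arrow_def PNP_simps
    by (intro conjI bexI[of _ "restrict (inv_into (carrier Q) f) (carrier R)"])
      (simp_all add: omagma_iso_compose_inv[OF f])
qed

lemma MS_iso_arrow:
  assumes f: "omagma_iso M N f" and "M \<in> Obj (MS_cat small)" "N \<in> Obj (MS_cat small)"
  shows "iso_arrow (MS_cat small) M N (restrict f (carrier M))"
proof -
  have "mult_semilattice_mor M N (restrict f (carrier M))"
    using assms by (intro mult_semilattice_mor_restrict omagma_iso_mult_semilattice_mor) simp_all
  moreover have "mult_semilattice_mor N M (restrict (inv_into (carrier M) f) (carrier N))"
    using assms by (intro mult_semilattice_mor_restrict omagma_iso_mult_semilattice_mor omagma_iso_inv)
      simp_all
  ultimately show ?thesis
    unfolding iso_arrow_def MS_simps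
    by (intro conjI bexI[of _ "restrict (inv_into (carrier M) f) (carrier N)"])
      (simp_all add: omagma_iso_compose_inv[OF f])
qed

text \<open>The size conditions match exactly, as the carrier of \<open>K_magma Q\<close> is the set
  \<open>compacts Q\<close> whose smallness is required of \<open>Q\<close>.\<close>

lemma cat_functor_K: "cat_functor (PNP_cat small) (MS_cat small) K_functor"
proof (intro cat_functor.intro cat_functor_axioms.intro PNP_category MS_category)
  fix Q R S :: "'a omagma" and f g
  show "on_obj K_functor Q \<in> Obj (MS_cat small)" if "Q \<in> Obj (PNP_cat small)"
    using that by (simp add: K_functor_def K_multiplicative_semilattice)
  show "on_arr K_functor Q R f \<in> Hom (MS_cat small) (on_obj K_functor Q) (on_obj K_functor R)"
    if "f \<in> Hom (PNP_cat small) Q R"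
    using that by (simp add: K_functor_def K_map_mor) (simp add: K_map_def)
  show "on_arr K_functor Q Q (Id (PNP_cat small) Q) = Id (MS_cat small) (on_obj K_functor Q)"
    using K_map_id[of Q] by (simp add: K_functor_def)
  show "on_arr K_functor Q S (Comp (PNP_cat small) Q R S g f) =
      Comp (MS_cat small) (on_obj K_functor Q) (on_obj K_functor R) (on_obj K_functor S)
        (on_arr K_functor R S g) (on_arr K_functor Q R f)"
    if "f \<in> Hom (PNP_cat small) Q R"
    using that K_map_compose[of Q R f g] by (simp add: K_functor_def)
qed

lemma compacts_below_iso:
  assumes Q: "precoherent_near_prequantale Q"
  shows "omagma_iso Q (Idl_magma (K_magma Q)) (compacts_below Q)"
proof (rule omagma_iso_cong[OF omagma_iso_inv[OF Sup_Idl_K_iso[OF Q]]])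
  fix x assume "x \<in> carrier Q"
  then show "inv_into (carrier (Idl_magma (K_magma Q))) (\<lambda>I. \<Squnion>\<^bsub>Q\<^esub>I) x = compacts_below Q x"
    using omagma_iso_simps(4)[OF Sup_Idl_K_iso[OF Q]]
    by (intro inv_into_f_eq) (simp_all add: compacts_below_ideal[OF Q] Sup_compacts_below[OF Q])
qed

text \<open>Naturality of an isomorphism passes to its inverse: \<open>compacts_below R\<close> is
  applied to both sides of the square for suprema in \<open>Sup_Idl_map_K_map\<close>.\<close>

lemma compacts_below_natural:
  assumes f: "precoherent_mor Q R f" and x: "x \<in> carrier Q"
  shows "compacts_below R (f x) =
    Idl_map (K_magma Q) (K_magma R) (K_map Q f) (compacts_below Q x)"
proof -
  note Q = precoherent_morD(1)[OF f] and R = precoherent_morD(2)[OF f]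
  note i = compacts_below_ideal[OF Q x]
  have "f x = \<Squnion>\<^bsub>R\<^esub>(Idl_map (K_magma Q) (K_magma R) (K_map Q f) (compacts_below Q x))"
    using Sup_Idl_map_K_map[OF f i] Sup_compacts_below[OF Q x] by simp
  then show ?thesis
    using compacts_below_Sup[OF R Idl_map_ideal[OF K_map_mor[OF f] i]] by simp
qed

section \<open>Ideals coded inside a universe\<close>

context
  fixes small :: "'v set \<Rightarrow> bool" and code :: "'v set \<Rightarrow> 'v"
  assumes U: "universe small code"
begin

abbreviation "coded_Idl M \<equiv> transport code (Idl_magma M)"

text \<open>\<open>code\<close> is injective on small sets only. Ideals are subsets of the small
  carrier of \<open>M\<close>, hence small.\<close>

lemma inj_on_code:
  assumes "M \<in> Obj (MS_cat small)"
  shows "inj_on code (order_ideals M)"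
proof (rule inj_on_subset)
  show "inj_on code {A. small A}" using U unfolding universe_def by blast
  have "small I" if "I \<subseteq> carrier M" for I
    using U assms that unfolding universe_def by (metis MS_simps(1))
  then show "order_ideals M \<subseteq> {A. small A}"
    unfolding order_ideals_def directed_subset_def by blast
qed

lemma coded_Idl_iso:
  assumes "M \<in> Obj (MS_cat small)"
  shows "omagma_iso (Idl_magma M) (coded_Idl M) code"
  using assms inj_on_code[OF assms] by (intro transport_iso Idl_ordered_magma) simp_all

lemma coded_Idl_carrier [simp]: "carrier (coded_Idl M) = code ` order_ideals M"
  by (simp add: transport_def Let_def)

text \<open>The compact elements of \<open>coded_Idl M\<close> are the codes of principal ideals, so
  they form an image of the small set \<open>carrier M\<close>. The set of all ideals is not claimed
  to be small, which is why the size condition concerns compact elements.\<close>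

lemma coded_Idl_Obj:
  assumes M: "M \<in> Obj (MS_cat small)"
  shows "coded_Idl M \<in> Obj (PNP_cat small)"
proof -
  from M have "precoherent_near_prequantale (Idl_magma M)"
    by (intro Idl_precoherent_near_prequantale) simp
  moreover have "small ((\<lambda>x. code (down_elem M x)) ` carrier M)"
    using U M unfolding universe_def by simp
  ultimately show ?thesis
    using M omagma_iso_precoherent_near_prequantale[OF coded_Idl_iso[OF M]]
    by (simp add: omagma_iso_compacts[OF coded_Idl_iso[OF M]] compacts_Idl image_image)
qed

lemma on_arr_Idl_functor:
  assumes "M \<in> Obj (MS_cat small)" "I \<in> order_ideals M"
  shows "on_arr (Idl_functor code) M N g (code I) = code (Idl_map M N g I)"
  using assms by (simp add: Idl_functor_def inj_on_code)

lemma coded_down_elem_iso: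
  assumes M: "M \<in> Obj (MS_cat small)"
  shows "omagma_iso M (K_magma (coded_Idl M)) (code \<circ> down_elem M)"
proof (rule omagma_iso_comp)
  from M have M': "multiplicative_semilattice M" by simp
  show "omagma_iso M (K_magma (Idl_magma M)) (\<lambda>x. down_elem M x)"
    by (rule down_elem_iso[OF M'])
  show "omagma_iso (K_magma (Idl_magma M)) (K_magma (coded_Idl M)) code"
    using coded_Idl_Obj[OF M] Idl_precoherent_near_prequantale[OF M']
    by (intro K_omagma_iso[OF coded_Idl_iso[OF M]] K_multiplicative_semilattice) simp_all
qed

lemma cat_functor_Idl: "cat_functor (MS_cat small) (PNP_cat small) (Idl_functor code)"
proof (intro cat_functor.intro cat_functor_axioms.intro PNP_category MS_category)
  fix M assume "M \<in> Obj (MS_cat small)"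
  then show "on_obj (Idl_functor code) M \<in> Obj (PNP_cat small)"
    using coded_Idl_Obj by (simp add: Idl_functor_def del: PNP_simps)
next
  fix M N g assume M: "M \<in> Obj (MS_cat small)" and N: "N \<in> Obj (MS_cat small)"
    and "g \<in> Hom (MS_cat small) M N"
  then have g: "mult_semilattice_mor M N g" by simp
  \<comment> \<open>The arrow is written as decoding, then \<open>Idl_map\<close>, then encoding.
    The outer two maps are isomorphisms of ordered magmas, so the composite is a morphism.\<close>
  let ?f = "compose (carrier (coded_Idl M)) code
    (compose (carrier (coded_Idl M)) (Idl_map M N g) (inv_into (order_ideals M) code))"
  have "precoherent_mor (coded_Idl M) (Idl_magma M) (inv_into (order_ideals M) code)"
    using omagma_iso_precoherent_mor[OF omagma_iso_inv[OF coded_Idl_iso[OF M]]] coded_Idl_Obj[OF M]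
    by simp
  moreover have "precoherent_mor (Idl_magma N) (coded_Idl N) code"
    using N by (intro omagma_iso_precoherent_mor[OF coded_Idl_iso] Idl_precoherent_near_prequantale)
      simp_all
  ultimately have "precoherent_mor (coded_Idl M) (coded_Idl N) ?f"
    using precoherent_mor_compose[OF precoherent_mor_compose[OF _ Idl_map_mor[OF g]]] by blast
  moreover have "?f = on_arr (Idl_functor code) M N g"
    by (auto simp: fun_eq_iff compose_def Idl_functor_def)
  ultimately show "on_arr (Idl_functor code) M N g
      \<in> Hom (PNP_cat small) (on_obj (Idl_functor code) M) (on_obj (Idl_functor code) N)"
    by (simp add: Idl_functor_def)
next
  fix M assume M: "M \<in> Obj (MS_cat small)"
  then have "Idl_map M M (\<lambda>x\<in>carrier M. x) I = I" if "I \<in> order_ideals M" for I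
    using that Idl_map_id[of M] by simp
  then show "on_arr (Idl_functor code) M M (Id (MS_cat small) M) =
      Id (PNP_cat small) (on_obj (Idl_functor code) M)"
    using inj_on_code[OF M] by (auto simp: Idl_functor_def fun_eq_iff)
next
  fix M N P g h
  assume M: "M \<in> Obj (MS_cat small)" and N: "N \<in> Obj (MS_cat small)"
    and "g \<in> Hom (MS_cat small) M N" "h \<in> Hom (MS_cat small) N P"
  then have g: "mult_semilattice_mor M N g" and h: "mult_semilattice_mor N P h" by simp_all
  let ?F = "Idl_functor code"
  \<comment> \<open>On the code of an ideal the claim is functoriality of \<open>Idl_map\<close>;
    away from the codes both sides are \<open>undefined\<close>.\<close>
  have "on_arr ?F M P (compose (carrier M) h g) y =
      compose (code ` order_ideals M) (on_arr ?F N P h) (on_arr ?F M N g) y" for y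
  proof (cases "y \<in> code ` order_ideals M")
    case True
    then obtain I where I: "y = code I" "I \<in> order_ideals M" by blast
    have "Idl_map M P (compose (carrier M) h g) I = Idl_map N P h (Idl_map M N g I)"
      using I by (simp add: Idl_map_compose[OF g h] compose_eq)
    with I show ?thesis
      using M N by (simp add: compose_def on_arr_Idl_functor Idl_map_ideal[OF g] del: MS_simps)
  qed (simp add: compose_def Idl_functor_def)
  then show "on_arr ?F M P (Comp (MS_cat small) M N P h g) =
      Comp (PNP_cat small) (on_obj ?F M) (on_obj ?F N) (on_obj ?F P) (on_arr ?F N P h) (on_arr ?F M N g)"
    by (auto simp: Idl_functor_def)
qed

text \<open>The unit of an equivalence starts at the identity functor, so I \<mapsto> \<Squnion>I is
  used in its inverse direction, followed by coding of the resulting ideal.\<close>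

lemma unit_natural_iso:
  "natural_iso (PNP_cat small) (PNP_cat small) id_ftor (comp_ftor (Idl_functor code) K_functor)
    (\<lambda>Q. restrict (code \<circ> compacts_below Q) (carrier Q))"
  unfolding natural_iso_def
proof (intro conjI ballI)
  show "cat_functor (PNP_cat small) (PNP_cat small) id_ftor"
    by (rule cat_functor_id[OF PNP_category])
  show "cat_functor (PNP_cat small) (PNP_cat small) (comp_ftor (Idl_functor code) K_functor)"
    by (rule cat_functor_comp[OF cat_functor_K cat_functor_Idl])
next
  fix Q assume Q: "Q \<in> Obj (PNP_cat small)"
  then have Q': "precoherent_near_prequantale Q" by simp
  have KQ: "K_magma Q \<in> Obj (MS_cat small)"
    using Q by (simp add: K_multiplicative_semilattice)
  have "omagma_iso Q (coded_Idl (K_magma Q)) (code \<circ> compacts_below Q)"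
    by (rule omagma_iso_comp[OF compacts_below_iso[OF Q'] coded_Idl_iso[OF KQ]])
  then show "iso_arrow (PNP_cat small) (on_obj id_ftor Q)
      (on_obj (comp_ftor (Idl_functor code) K_functor) Q) (restrict (code \<circ> compacts_below Q) (carrier Q))"
    using PNP_iso_arrow Q coded_Idl_Obj[OF KQ]
    by (simp add: id_ftor_def comp_ftor_def Idl_functor_def K_functor_def del: PNP_simps)
next
  fix Q R f assume Q: "Q \<in> Obj (PNP_cat small)" and R: "R \<in> Obj (PNP_cat small)"
    and "f \<in> Hom (PNP_cat small) Q R"
  then have f: "precoherent_mor Q R f" by simp
  have KQ: "K_magma Q \<in> Obj (MS_cat small)"
    using Q by (simp add: K_multiplicative_semilattice)
  have Q': "precoherent_near_prequantale Q" using Q by simp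
  have "code (compacts_below R (f x)) = on_arr (Idl_functor code) (K_magma Q) (K_magma R) (K_map Q f)
      (code (compacts_below Q x))" if "x \<in> carrier Q" for x
    using that by (simp add: on_arr_Idl_functor[OF KQ] compacts_below_ideal[OF Q'] compacts_below_natural[OF f])
  then show "Comp (PNP_cat small) (on_obj id_ftor Q) (on_obj id_ftor R)
      (on_obj (comp_ftor (Idl_functor code) K_functor) R)
      (restrict (code \<circ> compacts_below R) (carrier R)) (on_arr id_ftor Q R f) =
    Comp (PNP_cat small) (on_obj id_ftor Q) (on_obj (comp_ftor (Idl_functor code) K_functor) Q)
      (on_obj (comp_ftor (Idl_functor code) K_functor) R)
      (on_arr (comp_ftor (Idl_functor code) K_functor) Q R f) (restrict (code \<circ> compacts_below Q) (carrier Q))"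
    using precoherent_morD(3)[OF f]
    by (auto simp: id_ftor_def comp_ftor_def K_functor_def compose_def fun_eq_iff)
qed

text \<open>The counit ends at the identity functor, so it is the inverse of the coded map
  \<open>down_elem M\<close>: it sends the code of a principal ideal to its generator.\<close>

lemma counit_natural_iso:
  "natural_iso (MS_cat small) (MS_cat small) (comp_ftor K_functor (Idl_functor code)) id_ftor
    (\<lambda>M. restrict (inv_into (carrier M) (code \<circ> down_elem M)) (compacts (coded_Idl M)))"
  (is "natural_iso _ _ _ _ ?\<epsilon>")
  unfolding natural_iso_def
proof (intro conjI ballI)
  show "cat_functor (MS_cat small) (MS_cat small) id_ftor"
    by (rule cat_functor_id[OF MS_category])
  show "cat_functor (MS_cat small) (MS_cat small) (comp_ftor K_functor (Idl_functor code))"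
    by (rule cat_functor_comp[OF cat_functor_Idl cat_functor_K])
next
  fix M assume M: "M \<in> Obj (MS_cat small)"
  have "K_magma (coded_Idl M) \<in> Obj (MS_cat small)"
    using coded_Idl_Obj[OF M] by (simp add: K_multiplicative_semilattice)
  then show "iso_arrow (MS_cat small) (on_obj (comp_ftor K_functor (Idl_functor code)) M)
      (on_obj id_ftor M) (?\<epsilon> M)"
    using MS_iso_arrow[OF omagma_iso_inv[OF coded_down_elem_iso[OF M]]] M
    by (simp add: id_ftor_def comp_ftor_def Idl_functor_def K_functor_def del: MS_simps)
next
  fix M N g assume M: "M \<in> Obj (MS_cat small)" and N: "N \<in> Obj (MS_cat small)"
    and "g \<in> Hom (MS_cat small) M N"
  then have g: "mult_semilattice_mor M N g" by simp
  note eM = omagma_iso_simps[OF coded_down_elem_iso[OF M], simplified]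
    and eN = omagma_iso_simps[OF coded_down_elem_iso[OF N], simplified]
  let ?Fg = "restrict (on_arr (Idl_functor code) M N g) (compacts (coded_Idl M))"
  \<comment> \<open>Every compact element is the code of the principal ideal of some
    \<open>x\<close>. Along either side of the square it ends at \<open>g x\<close>, by
    \<open>Idl_map_down_elem\<close> and injectivity of the coded \<open>down_elem\<close>.\<close>
  have "compose (compacts (coded_Idl M)) (?\<epsilon> N) ?Fg y = compose (compacts (coded_Idl M)) g (?\<epsilon> M) y" for y
  proof (cases "y \<in> compacts (coded_Idl M)")
    case True
    then obtain x where x: "x \<in> carrier M" "y = code (down_elem M x)"
      using eM(5) by auto
    interpret M: multiplicative_semilattice M using M by simp
    have gx: "g x \<in> carrier N" using mult_semilattice_morD(3)[OF g] x by blast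
    have "on_arr (Idl_functor code) M N g y = code (down_elem N (g x))"
      using x by (simp add: on_arr_Idl_functor[OF M] M.down_elem_ideal Idl_map_down_elem[OF g])
    moreover have "inv_into (carrier M) (code \<circ> down_elem M) y = x"
      "inv_into (carrier N) (code \<circ> down_elem N) (code (down_elem N (g x))) = g x"
      using inv_into_f_f[OF eM(4) x(1)] inv_into_f_f[OF eN(4) gx] x(2) by simp_all
    ultimately show ?thesis
      using True eN(1)[OF gx] by (simp add: compose_def)
  qed (simp add: compose_def)
  then show "Comp (MS_cat small) (on_obj (comp_ftor K_functor (Idl_functor code)) M)
      (on_obj (comp_ftor K_functor (Idl_functor code)) N) (on_obj id_ftor N)
      (?\<epsilon> N) (on_arr (comp_ftor K_functor (Idl_functor code)) M N g) =
    Comp (MS_cat small) (on_obj (comp_ftor K_functor (Idl_functor code)) M)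
      (on_obj id_ftor M) (on_obj id_ftor N) (on_arr id_ftor M N g) (?\<epsilon> M)"
    by (auto simp: comp_ftor_def id_ftor_def K_functor_def K_map_def Idl_functor_def)
qed

end

lemma K_Idl_equivalence:
  assumes "universe small code"
  shows "cat_equivalence (PNP_cat small) (MS_cat small) K_functor (Idl_functor code)"
  unfolding cat_equivalence_def
  using cat_functor_K cat_functor_Idl[OF assms] unit_natural_iso[OF assms] counit_natural_iso[OF assms]
  by blast

text \<open>Each of the two categories gathers structures over one type, whereas forming ideals
  passes from a type to its type of sets. The functor laws and the naturality squares are therefore
  also stated across different types, and the equivalence is asserted for each choice of a
  universe.\<close>

theorem theorem6p15:
  fixes Q :: "'a omagma" and M :: "'b omagma"
  assumes "precoherent_near_prequantale Q"
    and "multiplicative_semilattice M"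
  shows
    "precoherent_near_prequantale (Idl_magma M) \<and>
     multiplicative_semilattice (K_magma Q) \<and>
     omagma_iso M (K_magma (Idl_magma M)) (\<lambda>x. down_elem M x) \<and>
     omagma_iso (Idl_magma (K_magma Q)) Q (\<lambda>I. \<Squnion>\<^bsub>Q\<^esub>I) \<and>
     (\<forall>(Q' :: 'c omagma) f. precoherent_mor Q Q' f \<longrightarrow>
        mult_semilattice_mor (K_magma Q) (K_magma Q') (K_map Q f)) \<and>
     (\<forall>(M' :: 'd omagma) g. mult_semilattice_mor M M' g \<longrightarrow>
        precoherent_mor (Idl_magma M) (Idl_magma M') (Idl_map M M' g)) \<and>
     \<comment> \<open>K and Idl are functorial, for arbitrary structures\<close>
     K_map Q (\<lambda>x\<in>carrier Q. x) = (\<lambda>x\<in>carrier (K_magma Q). x) \<and>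
     (\<forall>(Q' :: 'c omagma) (Q'' :: 'e omagma) f f'.
        precoherent_mor Q Q' f \<and> precoherent_mor Q' Q'' f' \<longrightarrow>
        K_map Q (compose (carrier Q) f' f) =
          compose (carrier (K_magma Q)) (K_map Q' f') (K_map Q f)) \<and>
     Idl_map M M (\<lambda>x\<in>carrier M. x) = (\<lambda>I\<in>carrier (Idl_magma M). I) \<and>
     (\<forall>(M' :: 'd omagma) (M'' :: 'f omagma) g g'.
        mult_semilattice_mor M M' g \<and> mult_semilattice_mor M' M'' g' \<longrightarrow>
        Idl_map M M'' (compose (carrier M) g' g) =
          compose (carrier (Idl_magma M)) (Idl_map M' M'' g') (Idl_map M M' g)) \<and>
     \<comment> \<open>the isomorphisms above are natural, for arbitrary structures\<close>
     (\<forall>(Q' :: 'c omagma) f. precoherent_mor Q Q' f \<longrightarrow>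
        (\<forall>I\<in>carrier (Idl_magma (K_magma Q)).
          \<Squnion>\<^bsub>Q'\<^esub>(Idl_map (K_magma Q) (K_magma Q') (K_map Q f) I) = f (\<Squnion>\<^bsub>Q\<^esub>I))) \<and>
     (\<forall>(M' :: 'd omagma) g. mult_semilattice_mor M M' g \<longrightarrow>
        (\<forall>x\<in>carrier M.
          K_map (Idl_magma M) (Idl_map M M' g) (down_elem M x) = down_elem M' (g x))) \<and>
     \<comment> \<open>K and Idl form an equivalence of categories, in every universe\<close>
     (\<forall>(small :: 'v set \<Rightarrow> bool) code. universe small code \<longrightarrow>
        cat_equivalence (PNP_cat small) (MS_cat small) K_functor (Idl_functor code))"
proof (intro conjI allI impI ballI)
  show "precoherent_near_prequantale (Idl_magma M)" "multiplicative_semilattice (K_magma Q)"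
    "omagma_iso M (K_magma (Idl_magma M)) (\<lambda>x. down_elem M x)"
    "omagma_iso (Idl_magma (K_magma Q)) Q (\<lambda>I. \<Squnion>\<^bsub>Q\<^esub>I)"
    "K_map Q (\<lambda>x\<in>carrier Q. x) = (\<lambda>x\<in>carrier (K_magma Q). x)"
    "Idl_map M M (\<lambda>x\<in>carrier M. x) = (\<lambda>I\<in>carrier (Idl_magma M). I)"
    using assms by (simp_all only: Idl_precoherent_near_prequantale K_multiplicative_semilattice
        down_elem_iso Sup_Idl_K_iso K_map_id Idl_map_id)
next
  fix M' :: "'d omagma" and g x
  assume g: "mult_semilattice_mor M M' g" and x: "x \<in> carrier M"
  then have "down_elem M x \<in> compacts (Idl_magma M)"
    by (simp add: compacts_Idl[OF assms(2)])
  then show "K_map (Idl_magma M) (Idl_map M M' g) (down_elem M x) = down_elem M' (g x)"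
    by (simp add: K_map_def Idl_map_down_elem[OF g x])
next
  fix M' :: "'d omagma" and M'' :: "'f omagma" and g g'
  assume "mult_semilattice_mor M M' g \<and> mult_semilattice_mor M' M'' g'"
  then show "Idl_map M M'' (compose (carrier M) g' g) =
      compose (carrier (Idl_magma M)) (Idl_map M' M'' g') (Idl_map M M' g)"
    using Idl_map_compose by blast
qed (simp_all only: K_map_mor Idl_map_mor K_map_compose Sup_Idl_map_K_map K_Idl_equivalence Idl_simps)

end
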